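(* For every net of conics $\mathcal{L}\subset\mathbb{S}^3$ of type $F$, the ML-base locus $\mathbb{P}\mathcal{L}^{-1}\cap\mathbb{P}\mathcal{L}^\perp$ is a double point of rank $1$ (i.e. as a scheme it is supported at a single point, which is a matrix of rank $1$, and has degree $2$), and the ML-degree of $\mathcal{L}$ is $0$.
   Context: Everything is over $\mathbb{C}$. $\mathbb{S}^3$ is the $6$-dimensional space of complex symmetric $3\times 3$ matrices, $\mathbb{P}^5=\mathbb{P}\mathbb{S}^3$. A net of conics is a $3$-dimensional linear subspace of $\mathbb{S}^3$. For a net $\mathcal{L}$ containing an invertible matrix, $\mathbb{P}\mathcal{L}^{-1}\subset\mathbb{P}^5$ is the Zariski closure of $\mathbb{P}(\{A^{-1} \mid A\in\mathcal{L},\ \det A\neq 0\})$. The polar net is $\mathcal{L}^\perp=\{N\in\mathbb{S}^3\mid \mathrm{trace}(MN)=0 \text{ for all } M\in\mathcal{L}\}$. The ML-base locus of $\mathcal{L}$ is the (scheme-theoretic) intersection $\mathbb{P}\mathcal{L}^{-1}\cap\mathbb{P}\mathcal{L}^\perp$. The ML-degree of $\mathcal{L}$ is the number of complex critical points on $\mathcal{L}$ of $\ell_S(M)=\log\det(M)-\mathrm{trace}(SM)$ for a generic matrix $S\in\mathbb{S}^3$; that is, the number of invertible $M\in\mathcal{L}$ with $\mathrm{trace}(M^{-1}N)=\mathrm{trace}(SN)$ for all $N\in\mathcal{L}$. A symmetric matrix $M$ is identified with the quadratic form $(x,y,z)M(x,y,z)^T$; e.g. $2xz$ is the matrix with entries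 $1$ at positions $(1,3),(3,1)$ and $0$ elsewhere. Two nets are congruent if $\mathcal{L}_2=g^T\mathcal{L}_1 g$ for some $g\in \mathrm{GL}(3,\mathbb{C})$. A net is of type $F$ if it is congruent to the net spanned by $x^2,\ y^2,\ 2xz+2yz$. *)

theory Defs
  imports
    "HOL-Analysis.Analysis"
    "HOL-Computational_Algebra.Polynomial"
    "HOL-Library.Poly_Mapping"
    "HOL-Library.Set_Algebras"
begin

section \<open>Symmetric matrices and nets of conics\<close>

definition Sym3 :: "(complex^3^3) set" where
  "Sym3 = {M. transpose M = M}"

text \<open>The real scaling of the type class \<open>real_vector\<close> does not suffice here: subspaces, spans
  and dimensions of matrices are taken over the complex numbers.\<close>

definition mscale :: "complex \<Rightarrow> complex^3^3 \<Rightarrow> complex^3^3" where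
  "mscale c A = (\<chi> i j. c * A $ i $ j)"

interpretation cmat: vector_space mscale
  by unfold_locales (simp_all add: mscale_def vec_eq_iff algebra_simps)

definition is_net :: "(complex^3^3) set \<Rightarrow> bool" where
  "is_net L \<longleftrightarrow> L \<subseteq> Sym3 \<and> cmat.subspace L \<and> cmat.dim L = 3"

definition congruent_nets :: "(complex^3^3) set \<Rightarrow> (complex^3^3) set \<Rightarrow> bool" where
  "congruent_nets L1 L2 \<longleftrightarrow>
     (\<exists>g :: complex^3^3. invertible g \<and> L2 = (\<lambda>M. transpose g ** M ** g) ` L1)"

definition quadratic_form :: "complex^3^3 \<Rightarrow> complex \<Rightarrow> complex \<Rightarrow> complex \<Rightarrow> complex" where
  "quadratic_form M x y z =
     (let v = (vector [x, y, z] :: complex^3) in \<Sum>i\<in>UNIV. \<Sum>j\<in>UNIV. v $ i * M $ i $ j * v $ j)"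

definition conic_xx :: "complex^3^3" where
  "conic_xx = vector [vector [1, 0, 0], vector [0, 0, 0], vector [0, 0, 0]]"

definition conic_yy :: "complex^3^3" where
  "conic_yy = vector [vector [0, 0, 0], vector [0, 1, 0], vector [0, 0, 0]]"

definition conic_2xz_2yz :: "complex^3^3" where
  "conic_2xz_2yz = vector [vector [0, 0, 1], vector [0, 0, 1], vector [1, 1, 0]]"

lemma quadratic_form_conics:
  "quadratic_form conic_xx x y z = x\<^sup>2"
  "quadratic_form conic_yy x y z = y\<^sup>2"
  "quadratic_form conic_2xz_2yz x y z = 2 * x * z + 2 * y * z"
  by (simp_all add: quadratic_form_def conic_xx_def conic_yy_def conic_2xz_2yz_def
      sum_3 power2_eq_square algebra_simps)

definition net_F :: "(complex^3^3) set" where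
  "net_F = cmat.span {conic_xx, conic_yy, conic_2xz_2yz}"

lemma is_net_net_F: "is_net net_F"
proof -
  have entries [simp]:
    "conic_xx $ i $ j = (if i = 1 \<and> j = 1 then 1 else 0)"
    "conic_yy $ i $ j = (if i = 2 \<and> j = 2 then 1 else 0)"
    "conic_2xz_2yz $ i $ j = (if (i = 3) \<noteq> (j = 3) then 1 else 0)" for i j
    using exhaust_3 [of i] exhaust_3 [of j]
    by (auto simp: conic_xx_def conic_yy_def conic_2xz_2yz_def)
  have sub: "cmat.subspace Sym3"
    unfolding cmat.subspace_def Sym3_def by (auto simp: transpose_def mscale_def vec_eq_iff)
  have "{conic_xx, conic_yy, conic_2xz_2yz} \<subseteq> Sym3"
    by (auto simp: Sym3_def transpose_def vec_eq_iff)
  then have "net_F \<subseteq> Sym3"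
    unfolding net_F_def using sub by (simp add: cmat.span_minimal)
  have neq: "conic_xx \<noteq> conic_yy" "conic_xx \<noteq> conic_2xz_2yz" "conic_yy \<noteq> conic_2xz_2yz"
    by (auto dest!: arg_cong [of _ _ "\<lambda>M. (M $ 1 $ 1, M $ 2 $ 2)"])
  have "conic_yy \<notin> cmat.span {conic_2xz_2yz}"
  proof -
    have "cmat.span {conic_2xz_2yz} \<subseteq> {M. M $ 2 $ 2 = 0}"
      by (rule cmat.span_minimal) (auto simp: cmat.subspace_def mscale_def)
    then show ?thesis by auto
  qed
  moreover have "conic_xx \<notin> cmat.span {conic_yy, conic_2xz_2yz}"
  proof -
    have "cmat.span {conic_yy, conic_2xz_2yz} \<subseteq> {M. M $ 1 $ 1 = 0}"
      by (rule cmat.span_minimal) (auto simp: cmat.subspace_def mscale_def)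
    then show ?thesis by auto
  qed
  moreover have "conic_2xz_2yz \<noteq> 0"
    by (auto dest: arg_cong [of _ _ "\<lambda>M. M $ 1 $ 3"])
  ultimately have "cmat.independent {conic_xx, conic_yy, conic_2xz_2yz}"
    using neq by (simp add: cmat.independent_insert)
  then have "cmat.dim net_F = 3"
    unfolding net_F_def using neq by (simp add: cmat.dim_eq_card_independent)
  then show ?thesis
    using \<open>net_F \<subseteq> Sym3\<close> by (simp add: is_net_def net_F_def)
qed

definition type_F :: "(complex^3^3) set \<Rightarrow> bool" where
  "type_F L \<longleftrightarrow> is_net L \<and> congruent_nets L net_F"


section \<open>Polynomials on the space of symmetric matrices\<close>

datatype coord = X11 | X12 | X13 | X22 | X23 | X33

type_synonym spoly = "(coord \<Rightarrow>\<^sub>0 nat) \<Rightarrow>\<^sub>0 complex"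

fun entry :: "complex^3^3 \<Rightarrow> coord \<Rightarrow> complex" where
  "entry A X11 = A $ 1 $ 1"
| "entry A X12 = A $ 1 $ 2"
| "entry A X13 = A $ 1 $ 3"
| "entry A X22 = A $ 2 $ 2"
| "entry A X23 = A $ 2 $ 3"
| "entry A X33 = A $ 3 $ 3"

definition evalp :: "spoly \<Rightarrow> complex^3^3 \<Rightarrow> complex" where
  "evalp f A = (\<Sum>m\<in>Poly_Mapping.keys f. Poly_Mapping.lookup f m *
     (\<Prod>v\<in>Poly_Mapping.keys m. entry A v ^ Poly_Mapping.lookup m v))"

definition homogeneous :: "nat \<Rightarrow> spoly \<Rightarrow> bool" where
  "homogeneous d f \<longleftrightarrow>
     (\<forall>m\<in>Poly_Mapping.keys f. (\<Sum>v\<in>Poly_Mapping.keys m. Poly_Mapping.lookup m v) = d)"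

text \<open>Multiplication of a polynomial by the constant polynomial \<open>c\<close>.\<close>

definition pscale :: "complex \<Rightarrow> spoly \<Rightarrow> spoly" where
  "pscale c f = Poly_Mapping.single 0 c * f"

interpretation spoly: vector_space pscale
proof
  show "pscale a (pscale b f) = pscale (a * b) f" for a b f
    by (simp add: pscale_def mult_single flip: mult.assoc)
qed (simp_all add: pscale_def distrib_left distrib_right single_add)


section \<open>Projective geometry in the space of symmetric matrices\<close>

text \<open>A point of projective 5-space is a one-dimensional subspace of \<open>Sym3\<close>;
  \<open>projectivization X\<close> is the set of lines through the nonzero elements of \<open>X\<close>.\<close>

definition projectivization :: "(complex^3^3) set \<Rightarrow> (complex^3^3) set set" where
  "projectivization X = {cmat.span {A} | A. A \<in> X \<and> A \<noteq> 0}"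

definition P5 :: "(complex^3^3) set set" where
  "P5 = projectivization Sym3"

text \<open>Vanishing on a whole line. For homogeneous \<open>f\<close> this can be tested at any nonzero
  representative; for general \<open>f\<close> it says that each homogeneous component vanishes there.\<close>

definition vanishes_at :: "spoly \<Rightarrow> (complex^3^3) set \<Rightarrow> bool" where
  "vanishes_at f P \<longleftrightarrow> (\<forall>A\<in>P. evalp f A = 0)"

definition zero_locus :: "spoly set \<Rightarrow> (complex^3^3) set set" where
  "zero_locus F = {P \<in> P5. \<forall>f\<in>F. vanishes_at f P}"

definition zariski_closed :: "(complex^3^3) set set \<Rightarrow> bool" where
  "zariski_closed Z \<longleftrightarrow> (\<exists>F. (\<forall>f\<in>F. \<exists>d. homogeneous d f) \<and> Z = zero_locus F)"

definition vanishing_ideal :: "(complex^3^3) set set \<Rightarrow> spoly set" where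
  "vanishing_ideal X = {f. \<forall>P\<in>X. vanishes_at f P}"


subsection \<open>Closed subschemes\<close>

text \<open>A closed subscheme of projective 5-space is given by a homogeneous ideal \<open>I\<close> of the
  coordinate ring \<open>R\<close>, as Proj of \<open>R / I\<close>. Its closed points form \<open>zero_locus I\<close>, varieties
  carry the reduced structure given by their vanishing ideals, and the scheme-theoretic
  intersection of two closed subschemes is given by the sum of their ideals. The Hilbert
  polynomial, and with it the degree, depends only on the subscheme, not on the choice of
  the ideal defining it.\<close>

text \<open>The dimension of the degree \<open>d\<close> part of \<open>R / I\<close>, for a homogeneous ideal \<open>I\<close>; both
  spaces are finite-dimensional.\<close>

definition hilbert_function :: "spoly set \<Rightarrow> nat \<Rightarrow> nat" where
  "hilbert_function I d =
     spoly.dim {f. homogeneous d f} - spoly.dim (I \<inter> {f. homogeneous d f})"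

definition hilbert_polynomial :: "spoly set \<Rightarrow> rat poly" where
  "hilbert_polynomial I =
     (THE q. \<exists>d0. \<forall>d\<ge>d0. poly q (of_nat d) = of_nat (hilbert_function I d))"

definition scheme_degree :: "spoly set \<Rightarrow> rat" where
  "scheme_degree I = (let q = hilbert_polynomial I
     in fact (Polynomial.degree q) * Polynomial.lead_coeff q)"

definition double_point_of_rank :: "spoly set \<Rightarrow> nat \<Rightarrow> bool" where
  "double_point_of_rank I r \<longleftrightarrow>
     (\<exists>A\<in>Sym3. rank A = r \<and> A \<noteq> 0 \<and> zero_locus I = {cmat.span {A}}) \<and> scheme_degree I = 2"


section \<open>Reciprocal variety, polar net, base locus and ML-degree\<close>

definition reciprocal_variety :: "(complex^3^3) set \<Rightarrow> (complex^3^3) set set" where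
  "reciprocal_variety L =
     zariski_closed hull projectivization {matrix_inv A | A. A \<in> L \<and> det A \<noteq> 0}"

definition polar_net :: "(complex^3^3) set \<Rightarrow> (complex^3^3) set" where
  "polar_net L = {N \<in> Sym3. \<forall>M\<in>L. trace (M ** N) = 0}"

text \<open>The base locus as a scheme, represented by its homogeneous ideal.\<close>

definition ml_base_locus :: "(complex^3^3) set \<Rightarrow> spoly set" where
  "ml_base_locus L =
     vanishing_ideal (reciprocal_variety L) + vanishing_ideal (projectivization (polar_net L))"

text \<open>The critical points on \<open>L\<close> of \<open>log (det M) - trace (S M)\<close>: the derivative in direction \<open>N\<close>
  is \<open>trace (M\<inverse> N) - trace (S N)\<close>, whichever branch of the logarithm is used.\<close>

definition critical_points :: "(complex^3^3) set \<Rightarrow> complex^3^3 \<Rightarrow> (complex^3^3) set" where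
  "critical_points L S =
     {M \<in> L. invertible M \<and> (\<forall>N\<in>L. trace (matrix_inv M ** N) = trace (S ** N))}"

text \<open>A property holds for generic \<open>S\<close> if it holds on a nonempty Zariski open subset of
  \<open>Sym3\<close>, equivalently off the zero set of some nonzero polynomial.\<close>

definition for_generic :: "(complex^3^3 \<Rightarrow> bool) \<Rightarrow> bool" where
  "for_generic Q \<longleftrightarrow> (\<exists>f :: spoly. f \<noteq> 0 \<and> (\<forall>S\<in>Sym3. evalp f S \<noteq> 0 \<longrightarrow> Q S))"

definition ml_degree :: "(complex^3^3) set \<Rightarrow> nat" where
  "ml_degree L =
     (THE n. for_generic (\<lambda>S. finite (critical_points L S) \<and> card (critical_points L S) = n))"

end

theory Submission
  imports Defs
begin

text \<open>For the standard net, inverting matrices gives the quadric surface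
  \<open>x\<^sub>1\<^sub>1 = x\<^sub>2\<^sub>2 = - x\<^sub>1\<^sub>2\<close>, \<open>x\<^sub>1\<^sub>3 x\<^sub>2\<^sub>3 + x\<^sub>1\<^sub>1 x\<^sub>3\<^sub>3 = 0\<close>, and the polar net is
  \<open>x\<^sub>1\<^sub>1 = x\<^sub>2\<^sub>2 = x\<^sub>1\<^sub>3 + x\<^sub>2\<^sub>3 = 0\<close>. The sum of the two ideals contains
  \<open>x\<^sub>1\<^sub>1, x\<^sub>1\<^sub>2, x\<^sub>2\<^sub>2, x\<^sub>1\<^sub>3 + x\<^sub>2\<^sub>3, x\<^sub>1\<^sub>3\<^sup>2\<close>, so modulo it every form of degree \<open>n + 1\<close> is a combination of
  \<open>x\<^sub>3\<^sub>3\<^sup>n\<^sup>+\<^sup>1\<close> and \<open>x\<^sub>1\<^sub>3 x\<^sub>3\<^sub>3\<^sup>n\<close>. These are independent because every element of the ideal vanishes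
  to second order along a curve through the support that lies in the polar net and is tangent to the
  quadric. Congruence by \<open>g\<close> acts on both varieties through \<open>A \<mapsto> g A g\<^sup>T\<close>, hence on the ideals
  through the corresponding linear substitution. Finally, \<open>x\<^sub>1\<^sub>1 = x\<^sub>2\<^sub>2\<close> on the quadric, whereas the
  critical equations prescribe these two entries independently for generic \<open>S\<close>.\<close>

section \<open>Substitution into polynomials\<close>

lemma UNIV_coord: "UNIV = {X11, X12, X13, X22, X23, X33}"
  using coord.exhaust by auto

instance coord :: finite
  by standard (simp add: UNIV_coord)

definition mdeg :: "(coord \<Rightarrow>\<^sub>0 nat) \<Rightarrow> nat" where
  "mdeg m = (\<Sum>v\<in>UNIV. Poly_Mapping.lookup m v)"

definition monom_subst :: "(coord \<Rightarrow> 'b::comm_ring_1) \<Rightarrow> (coord \<Rightarrow>\<^sub>0 nat) \<Rightarrow> 'b" where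
  "monom_subst p m = (\<Prod>v\<in>UNIV. p v ^ Poly_Mapping.lookup m v)"

text \<open>The evaluation homomorphism that maps coefficients by \<open>h\<close> and sends each
  variable \<open>v\<close> to \<open>p v\<close>. With values in any commutative ring it covers
  evaluation at a matrix, linear substitution and restriction to a curve.\<close>

definition psubst :: "(complex \<Rightarrow> 'b) \<Rightarrow> (coord \<Rightarrow> 'b) \<Rightarrow> spoly \<Rightarrow> 'b::comm_ring_1" where
  "psubst h p f = (\<Sum>m\<in>Poly_Mapping.keys f. h (Poly_Mapping.lookup f m) * monom_subst p m)"

locale ring_hom_fun =
  fixes h :: "'a::comm_ring_1 \<Rightarrow> 'b::comm_ring_1"
  assumes add: "h (a + b) = h a + h b"
    and mult: "h (a * b) = h a * h b"
    and one: "h 1 = 1"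
begin

lemma zero: "h 0 = 0"
  using add [of 0 0] by simp

lemma uminus: "h (- a) = - h a"
  using add [of a "- a"] by (simp add: zero add_eq_0_iff)

lemma diff: "h (a - b) = h a - h b"
  using add [of a "- b"] by (simp add: uminus)

lemma sum: "h (sum f S) = (\<Sum>x\<in>S. h (f x))"
  by (induction S rule: infinite_finite_induct) (simp_all add: zero add)

lemma prod: "h (prod f S) = (\<Prod>x\<in>S. h (f x))"
  by (induction S rule: infinite_finite_induct) (simp_all add: one mult)

lemma power: "h (a ^ n) = h a ^ n"
  by (induction n) (simp_all add: one mult)

end

lemma monom_subst_add: "monom_subst p (m + n) = monom_subst p m * monom_subst p n"
  by (simp add: monom_subst_def lookup_add power_add prod.distrib)

lemma monom_subst_zero [simp]: "monom_subst p 0 = 1"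
  by (simp add: monom_subst_def)

lemma monom_subst_single: "monom_subst p (Poly_Mapping.single v n) = p v ^ n"
proof -
  have "monom_subst p (Poly_Mapping.single v n) = (\<Prod>w\<in>UNIV. if w = v then p v ^ n else 1)"
    unfolding monom_subst_def by (rule prod.cong) (auto simp: lookup_single)
  then show ?thesis by simp
qed

lemma spoly_expand:
  "(f :: spoly) = (\<Sum>m\<in>Poly_Mapping.keys f. Poly_Mapping.single m (Poly_Mapping.lookup f m))"
proof (rule poly_mapping_eqI)
  fix k
  have "Poly_Mapping.lookup (\<Sum>m\<in>Poly_Mapping.keys f. Poly_Mapping.single m (Poly_Mapping.lookup f m)) k
      = (\<Sum>m\<in>Poly_Mapping.keys f. if m = k then Poly_Mapping.lookup f k else 0)"
    unfolding lookup_sum by (rule sum.cong) (auto simp: lookup_single when_def)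
  then show "Poly_Mapping.lookup f k =
      Poly_Mapping.lookup (\<Sum>m\<in>Poly_Mapping.keys f. Poly_Mapping.single m (Poly_Mapping.lookup f m)) k"
    by (simp add: in_keys_iff)
qed

context ring_hom_fun
begin

lemma monom_subst_hom: "h (monom_subst p m) = monom_subst (\<lambda>v. h (p v)) m"
  by (simp add: monom_subst_def prod power)

lemma psubst_hom: "h (psubst k p f) = psubst (\<lambda>c. h (k c)) (\<lambda>v. h (p v)) f"
  by (simp add: psubst_def sum mult monom_subst_hom)

end

locale coeff_hom = ring_hom_fun h for h :: "complex \<Rightarrow> 'b::comm_ring_1"
begin

lemma psubst_superset:
  assumes "finite S" "Poly_Mapping.keys f \<subseteq> S"
  shows "psubst h p f = (\<Sum>m\<in>S. h (Poly_Mapping.lookup f m) * monom_subst p m)"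
  unfolding psubst_def using assms
  by (intro sum.mono_neutral_left) (auto simp: zero in_keys_iff)

lemma psubst_single: "psubst h p (Poly_Mapping.single m c) = h c * monom_subst p m"
  by (simp add: psubst_superset [where S = "{m}"])

lemma psubst_add: "psubst h p (f + g) = psubst h p f + psubst h p g"
proof -
  let ?S = "Poly_Mapping.keys f \<union> Poly_Mapping.keys g"
  have "finite ?S" by simp
  then show ?thesis
    using keys_add [of f g]
    by (simp add: psubst_superset [where S = ?S] lookup_add add algebra_simps sum.distrib)
qed

lemma psubst_zero: "psubst h p 0 = 0"
  by (simp add: psubst_def)

lemma psubst_sum: "psubst h p (sum F S) = (\<Sum>x\<in>S. psubst h p (F x))"
  by (induction S rule: infinite_finite_induct) (simp_all add: psubst_zero psubst_add)

lemma psubst_mult: "psubst h p (f * g) = psubst h p f * psubst h p g"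
proof -
  have "f * g = (\<Sum>m\<in>Poly_Mapping.keys f. \<Sum>n\<in>Poly_Mapping.keys g.
      Poly_Mapping.single (m + n) (Poly_Mapping.lookup f m * Poly_Mapping.lookup g n))"
    by (subst (1) spoly_expand [of f], subst (1) spoly_expand [of g])
      (simp add: sum_product mult_single)
  then show ?thesis
    by (simp add: psubst_sum psubst_single mult monom_subst_add)
      (simp add: psubst_def sum_product algebra_simps)
qed

lemma psubst_one: "psubst h p 1 = 1"
  using psubst_single [of p 0 1] by (simp add: one)

sublocale psubst: ring_hom_fun "psubst h p" for p
  by unfold_locales (rule psubst_add psubst_mult psubst_one)+

end

definition Const :: "complex \<Rightarrow> spoly" where
  "Const c = Poly_Mapping.single 0 c"

definition Var :: "coord \<Rightarrow> spoly" where
  "Var v = Poly_Mapping.single (Poly_Mapping.single v 1) 1"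

lemma pscale_eq: "pscale c f = Const c * f"
  by (simp add: pscale_def Const_def)

interpretation id_hom: coeff_hom "\<lambda>c. c"
  by unfold_locales simp_all

interpretation const_hom: coeff_hom Const
  by unfold_locales (simp_all add: Const_def single_add mult_single)

interpretation cpoly_hom: coeff_hom "\<lambda>c. [:c:]"
  by unfold_locales simp_all

interpretation poly_hom: ring_hom_fun "\<lambda>q. poly q t" for t :: complex
  by unfold_locales simp_all

lemma (in coeff_hom) psubst_Var: "psubst h p (Var v) = p v"
  by (simp add: Var_def psubst_single monom_subst_single one)

lemma (in coeff_hom) psubst_Const: "psubst h p (Const c) = h c"
  by (simp add: Const_def psubst_single)

lemma monom_subst_Var: "monom_subst Var m = Poly_Mapping.single m 1"
proof -
  have *: "Var v ^ n = Poly_Mapping.single (Poly_Mapping.single v n) 1" for v n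
    by (induction n) (simp_all add: Var_def mult_single flip: single_add)
  have **: "(\<Prod>v\<in>S. Poly_Mapping.single (F v) (1 :: complex)) = Poly_Mapping.single (sum F S) 1"
    if "finite S" for S and F :: "coord \<Rightarrow> coord \<Rightarrow>\<^sub>0 nat"
    using that by (induction S) (simp_all add: mult_single)
  have "(\<Sum>v\<in>UNIV. Poly_Mapping.single v (Poly_Mapping.lookup m v)) = m"
  proof (rule poly_mapping_eqI)
    fix w
    have "Poly_Mapping.lookup (\<Sum>v\<in>UNIV. Poly_Mapping.single v (Poly_Mapping.lookup m v)) w
       = (\<Sum>v\<in>UNIV. if v = w then Poly_Mapping.lookup m w else 0)"
      unfolding lookup_sum by (rule sum.cong) (auto simp: lookup_single when_def)
    then show "Poly_Mapping.lookup (\<Sum>v\<in>UNIV. Poly_Mapping.single v (Poly_Mapping.lookup m v)) w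
        = Poly_Mapping.lookup m w" by simp
  qed
  then show ?thesis
    by (simp add: monom_subst_def * **)
qed

text \<open>Presents a polynomial as a substitution into itself, so that
  \<open>psubst_ideal_cong\<close> can replace its variables by congruent polynomials.\<close>

lemma psubst_Const_Var: "psubst Const Var f = f"
proof -
  have "psubst Const Var f =
      (\<Sum>m\<in>Poly_Mapping.keys f. Poly_Mapping.single m (Poly_Mapping.lookup f m))"
    by (simp add: psubst_def monom_subst_Var Const_def mult_single)
  then show ?thesis
    using spoly_expand [of f] by simp
qed

section \<open>Congruence modulo an ideal\<close>

definition ring_ideal :: "'b::comm_ring_1 set \<Rightarrow> bool" where
  "ring_ideal I \<longleftrightarrow> 0 \<in> I \<and> (\<forall>a\<in>I. \<forall>b\<in>I. a + b \<in> I) \<and> (\<forall>a\<in>I. \<forall>r. r * a \<in> I)"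

lemma ring_idealD:
  assumes "ring_ideal I"
  shows "0 \<in> I" "a \<in> I \<Longrightarrow> b \<in> I \<Longrightarrow> a + b \<in> I" "a \<in> I \<Longrightarrow> r * a \<in> I" "a \<in> I \<Longrightarrow> a * r \<in> I"
    "a \<in> I \<Longrightarrow> - a \<in> I" "a \<in> I \<Longrightarrow> b \<in> I \<Longrightarrow> a - b \<in> I"
proof -
  show *: "0 \<in> I" "a \<in> I \<Longrightarrow> b \<in> I \<Longrightarrow> a + b \<in> I" "a \<in> I \<Longrightarrow> r * a \<in> I" for a b r
    using assms by (auto simp: ring_ideal_def)
  show "a \<in> I \<Longrightarrow> a * r \<in> I"
    using *(3) [of a r] by (simp add: mult.commute)
  show m: "a \<in> I \<Longrightarrow> - a \<in> I" for a
    using *(3) [of a "- 1"] by simp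
  show "a \<in> I \<Longrightarrow> b \<in> I \<Longrightarrow> a - b \<in> I"
    using *(2) [of a "- b"] m [of b] by simp
qed

lemma ring_ideal_sum: "ring_ideal I \<Longrightarrow> (\<And>x. x \<in> S \<Longrightarrow> F x \<in> I) \<Longrightarrow> sum F S \<in> I"
  by (induction S rule: infinite_finite_induct) (auto intro: ring_idealD)

lemma ring_ideal_mult_cong:
  assumes "ring_ideal I" "a - b \<in> I" "c - d \<in> I"
  shows "a * c - b * d \<in> I"
proof -
  have "a * c - b * d = (a - b) * c + b * (c - d)" by (simp add: algebra_simps)
  then show ?thesis using assms by (simp add: ring_idealD)
qed

lemma ring_ideal_power_cong:
  assumes "ring_ideal I" "a - b \<in> I"
  shows "a ^ n - b ^ n \<in> I"
  by (induction n) (auto simp: assms ring_idealD intro!: ring_ideal_mult_cong)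

lemma ring_ideal_prod_cong:
  assumes "ring_ideal I" "\<And>x. x \<in> S \<Longrightarrow> F x - G x \<in> I"
  shows "prod F S - prod G S \<in> I"
  using assms(2)
  by (induction S rule: infinite_finite_induct) (auto simp: assms(1) ring_idealD intro!: ring_ideal_mult_cong)

text \<open>Sums and products respect congruence modulo an ideal, hence so does substitution. The
  ideal is later either that of the base locus or the one generated by the square of a curve
  parameter.\<close>

lemma psubst_ideal_cong:
  assumes I: "ring_ideal I" and d: "\<And>v. p v - q v \<in> I"
  shows "psubst h p f - psubst h q f \<in> I"
proof -
  have "psubst h p f - psubst h q f =
      (\<Sum>m\<in>Poly_Mapping.keys f. h (Poly_Mapping.lookup f m) * (monom_subst p m - monom_subst q m))"
    by (simp add: psubst_def algebra_simps sum_subtractf)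
  moreover have "monom_subst p m - monom_subst q m \<in> I" for m
    unfolding monom_subst_def by (intro ring_ideal_prod_cong ring_ideal_power_cong I d)
  ultimately show ?thesis
    by (simp add: I ring_ideal_sum ring_idealD)
qed

section \<open>Homogeneous polynomials\<close>

lemma mdeg_eq: "(\<Sum>v\<in>Poly_Mapping.keys m. Poly_Mapping.lookup m v) = mdeg m"
  unfolding mdeg_def by (rule sum.mono_neutral_left) (auto simp: in_keys_iff)

lemma homogeneous_iff: "homogeneous d f \<longleftrightarrow> (\<forall>m\<in>Poly_Mapping.keys f. mdeg m = d)"
  by (simp add: homogeneous_def mdeg_eq)

lemma mdeg_add: "mdeg (m + n) = mdeg m + mdeg n"
  by (simp add: mdeg_def lookup_add sum.distrib)

lemma mdeg_single: "mdeg (Poly_Mapping.single v n) = n"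
proof -
  have "mdeg (Poly_Mapping.single v n) = (\<Sum>w\<in>UNIV. if w = v then n else 0)"
    unfolding mdeg_def by (rule sum.cong) (auto simp: lookup_single)
  then show ?thesis by simp
qed

lemma homogeneous_zero: "homogeneous d 0"
  by (simp add: homogeneous_iff)

lemma homogeneous_add: "homogeneous d f \<Longrightarrow> homogeneous d g \<Longrightarrow> homogeneous d (f + g)"
  using keys_add [of f g] by (auto simp: homogeneous_iff)

lemma homogeneous_mult: "homogeneous d f \<Longrightarrow> homogeneous e g \<Longrightarrow> homogeneous (d + e) (f * g)"
  using keys_mult [of f g] by (fastforce simp: homogeneous_iff mdeg_add)

lemma homogeneous_Const: "homogeneous 0 (Const c)"
  by (auto simp: homogeneous_iff Const_def mdeg_def)

lemma homogeneous_Var: "homogeneous 1 (Var v)"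
  by (auto simp: homogeneous_iff Var_def mdeg_single)

lemma homogeneous_pscale: "homogeneous d f \<Longrightarrow> homogeneous d (pscale c f)"
  using homogeneous_mult [OF homogeneous_Const] by (simp add: pscale_eq)

lemma homogeneous_sum: "(\<And>x. x \<in> S \<Longrightarrow> homogeneous d (F x)) \<Longrightarrow> homogeneous d (sum F S)"
  by (induction S rule: infinite_finite_induct) (auto intro: homogeneous_zero homogeneous_add)

lemma homogeneous_power: "homogeneous d f \<Longrightarrow> homogeneous (n * d) (f ^ n)"
proof (induction n)
  case 0
  then show ?case using homogeneous_Const [of 1] by (simp add: Const_def)
next
  case (Suc n)
  then show ?case using homogeneous_mult [of d f "n * d" "f ^ n"] by simp
qed

lemma homogeneous_prod:
  "(\<And>x. x \<in> S \<Longrightarrow> homogeneous (e x) (F x)) \<Longrightarrow> homogeneous (sum e S) (prod F S)"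
proof (induction S rule: infinite_finite_induct)
  case (insert x S)
  then show ?case by (auto intro: homogeneous_mult)
qed (use homogeneous_Const [of 1] in \<open>simp_all add: Const_def\<close>)

lemma homogeneous_psubst:
  assumes "homogeneous d f" "\<And>v. homogeneous 1 (p v)"
  shows "homogeneous d (psubst Const p f)"
  unfolding psubst_def
proof (rule homogeneous_sum)
  fix m assume "m \<in> Poly_Mapping.keys f"
  then have d: "mdeg m = d" using assms(1) by (simp add: homogeneous_iff)
  have "homogeneous (Poly_Mapping.lookup m v) (p v ^ Poly_Mapping.lookup m v)" for v
    using homogeneous_power [OF assms(2), of "Poly_Mapping.lookup m v" v] by simp
  then have "homogeneous (mdeg m) (monom_subst p m)"
    unfolding monom_subst_def mdeg_def by (intro homogeneous_prod)
  then show "homogeneous d (Const (Poly_Mapping.lookup f m) * monom_subst p m)"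
    using homogeneous_mult [OF homogeneous_Const] d by fastforce
qed

section \<open>Finite dimension of the spaces of forms\<close>

text \<open>Each exponent is at most the total degree, so these monomials inject into the functions
  from six coordinates to a finite set.\<close>

lemma finite_mdeg: "finite {m. mdeg m = d}"
proof -
  have "Poly_Mapping.lookup ` {m. mdeg m = d} \<subseteq> UNIV \<rightarrow>\<^sub>E {..d}"
  proof safe
    fix m v assume "d = mdeg m"
    then show "Poly_Mapping.lookup m v \<le> mdeg m"
      by (auto simp: mdeg_def intro: member_le_sum)
  qed auto
  then have "finite (Poly_Mapping.lookup ` {m. mdeg m = d})"
    by (rule finite_subset) (intro finite_PiE finite_code finite_atMost finite)
  then show ?thesis
    by (rule finite_imageD) (auto simp: inj_on_def)
qed

lemma homogeneous_finite_span:
  obtains B where "finite B" "{f. homogeneous d f} \<subseteq> spoly.span B"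
proof
  let ?B = "(\<lambda>m. Poly_Mapping.single m 1) ` {m. mdeg m = d} :: spoly set"
  show "finite ?B" by (simp add: finite_mdeg)
  show "{f. homogeneous d f} \<subseteq> spoly.span ?B"
  proof safe
    fix f assume f: "homogeneous d f"
    have "Poly_Mapping.single m (Poly_Mapping.lookup f m) \<in> spoly.span ?B"
      if "m \<in> Poly_Mapping.keys f" for m
    proof -
      have "pscale (Poly_Mapping.lookup f m) (Poly_Mapping.single m 1) \<in> spoly.span ?B"
        using that f by (intro spoly.span_scale spoly.span_base) (auto simp: homogeneous_iff)
      then show ?thesis by (simp add: pscale_def mult_single)
    qed
    then show "f \<in> spoly.span ?B"
      by (subst spoly_expand) (rule spoly.span_sum)
  qed
qed

section \<open>Evaluation at symmetric matrices\<close>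

lemma evalp_eq: "evalp f A = psubst (\<lambda>c. c) (entry A) f"
proof -
  have "(\<Prod>v\<in>Poly_Mapping.keys m. entry A v ^ Poly_Mapping.lookup m v) = monom_subst (entry A) m" for m
    unfolding monom_subst_def by (rule prod.mono_neutral_left) (auto simp: in_keys_iff)
  then show ?thesis
    by (simp add: evalp_def psubst_def)
qed

interpretation evalp: ring_hom_fun "\<lambda>f. evalp f A" for A
  unfolding evalp_eq by unfold_locales (simp_all add: id_hom.psubst.add id_hom.psubst.mult id_hom.psubst.one)

lemma evalp_Var [simp]: "evalp (Var v) A = entry A v"
  by (simp add: evalp_eq id_hom.psubst_Var)

lemma evalp_Const [simp]: "evalp (Const c) A = c"
  by (simp add: evalp_eq id_hom.psubst_Const)

text \<open>The inverse of \<open>entry\<close> on \<open>Sym3\<close>: the coordinates are the six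
  entries on and above the diagonal.\<close>

definition symm :: "(coord \<Rightarrow> complex) \<Rightarrow> complex^3^3" where
  "symm x = vector [vector [x X11, x X12, x X13], vector [x X12, x X22, x X23],
     vector [x X13, x X23, x X33]]"

lemma symm_in_Sym3 [simp]: "symm x \<in> Sym3"
  by (simp add: Sym3_def symm_def transpose_def vec_eq_iff forall_3)

lemma entry_symm [simp]: "entry (symm x) = x"
proof
  fix v show "entry (symm x) v = x v"
    by (cases v) (simp_all add: symm_def)
qed

lemma Sym3_nth: "A \<in> Sym3 \<Longrightarrow> A $ i $ j = A $ j $ i"
  unfolding Sym3_def by (metis (mono_tags, lifting) mem_Collect_eq transpose_def vec_lambda_beta)

lemma symm_entry: "A \<in> Sym3 \<Longrightarrow> symm (entry A) = A"
  by (simp add: symm_def vec_eq_iff forall_3 Sym3_nth [of A 2 1] Sym3_nth [of A 3 1] Sym3_nth [of A 3 2])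

lemma Sym3_eqI: "A \<in> Sym3 \<Longrightarrow> B \<in> Sym3 \<Longrightarrow> (\<And>v. entry A v = entry B v) \<Longrightarrow> A = B"
  by (metis symm_entry ext)

lemma mscale_nth [simp]: "mscale c A $ i $ j = c * A $ i $ j"
  by (simp add: mscale_def)

lemma entry_mscale [simp]: "entry (mscale c A) v = c * entry A v"
  by (cases v) simp_all

lemma mscale_Sym3: "A \<in> Sym3 \<Longrightarrow> mscale c A \<in> Sym3"
  by (simp add: Sym3_def mscale_def transpose_def vec_eq_iff)

text \<open>The restriction of \<open>f\<close> to a polynomial curve is a polynomial in the
  parameter. This turns vanishing at points of the curve into statements about roots and
  divisibility.\<close>

lemma evalp_symm_poly:
  "evalp f (symm (\<lambda>v. poly (p v) t)) = poly (psubst (\<lambda>c. [:c:]) p f) t"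
  by (simp add: evalp_eq poly_hom.psubst_hom)

text \<open>Kronecker's substitution: writing the exponents of a monomial as the digits of a number in
  a large base \<open>N\<close> turns distinct monomials into distinct powers of one variable.\<close>

fun kron :: "nat \<Rightarrow> coord \<Rightarrow> nat" where
  "kron N X11 = 1"
| "kron N X12 = N"
| "kron N X13 = N * N"
| "kron N X22 = N * (N * N)"
| "kron N X23 = N * (N * (N * N))"
| "kron N X33 = N * (N * (N * (N * N)))"

lemma digit_cancel:
  fixes a b c d N :: nat
  assumes "a + N * b = c + N * d" "a < N" "c < N"
  shows "a = c \<and> b = d"
proof -
  have "(a + N * b) mod N = (c + N * d) mod N" "(a + N * b) div N = (c + N * d) div N"
    using assms(1) by simp_all
  then show ?thesis using assms(2,3) by simp
qed

lemma kron_inj: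
  assumes eq: "(\<Sum>v\<in>UNIV. Poly_Mapping.lookup m v * kron N v) = (\<Sum>v\<in>UNIV. Poly_Mapping.lookup n v * kron N v)"
    and less: "\<And>v. Poly_Mapping.lookup m v < N" "\<And>v. Poly_Mapping.lookup n v < N"
  shows "m = n"
proof (rule poly_mapping_eqI)
  fix v
  \<comment> \<open>Horner form of the exponent, from which the base \<open>N\<close> digits are
    split off one at a time.\<close>
  let ?h = "\<lambda>m. Poly_Mapping.lookup m X11 + N * (Poly_Mapping.lookup m X12 + N *
    (Poly_Mapping.lookup m X13 + N * (Poly_Mapping.lookup m X22 + N *
    (Poly_Mapping.lookup m X23 + N * Poly_Mapping.lookup m X33))))"
  have "?h m = ?h n"
    using eq by (simp add: UNIV_coord algebra_simps)
  note 1 = digit_cancel [OF this less(1) less(2)]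
  note 2 = digit_cancel [OF 1 [THEN conjunct2] less(1) less(2)]
  note 3 = digit_cancel [OF 2 [THEN conjunct2] less(1) less(2)]
  note 4 = digit_cancel [OF 3 [THEN conjunct2] less(1) less(2)]
  note 5 = digit_cancel [OF 4 [THEN conjunct2] less(1) less(2)]
  show "Poly_Mapping.lookup m v = Poly_Mapping.lookup n v"
    using 1 2 3 4 5 by (cases v) simp_all
qed

text \<open>A base above all exponents keeps the monomials of \<open>f\<close> apart, so the
  coefficient at \<open>e m\<close> comes from the monomial \<open>m\<close> alone.\<close>

lemma psubst_kron_nonzero:
  assumes "f \<noteq> 0" and N: "\<And>m v. m \<in> Poly_Mapping.keys f \<Longrightarrow> Poly_Mapping.lookup m v < N"
  shows "psubst (\<lambda>c. [:c:]) (\<lambda>v. monom 1 (kron N v)) f \<noteq> 0"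
proof -
  define e where "e m = (\<Sum>v\<in>UNIV. Poly_Mapping.lookup m v * kron N v)" for m
  have e: "monom_subst (\<lambda>v. monom 1 (kron N v)) m = (monom 1 (e m) :: complex poly)" for m
  proof -
    have "(\<Prod>v\<in>S. monom 1 (kron N v) ^ Poly_Mapping.lookup m v) =
        (monom 1 (\<Sum>v\<in>S. Poly_Mapping.lookup m v * kron N v) :: complex poly)" if "finite S" for S
      using that
      by (induction S) (simp_all add: monom_power mult_monom mult.commute)
    then show ?thesis by (simp add: monom_subst_def e_def)
  qed
  from \<open>f \<noteq> 0\<close> obtain m where m: "m \<in> Poly_Mapping.keys f"
    using keys_eq_empty by fastforce
  have "coeff (psubst (\<lambda>c. [:c:]) (\<lambda>v. monom 1 (kron N v)) f) (e m) =
      (\<Sum>n\<in>Poly_Mapping.keys f. if n = m then Poly_Mapping.lookup f m else 0)"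
    unfolding psubst_def coeff_sum e
  proof (rule sum.cong)
    fix n assume "n \<in> Poly_Mapping.keys f"
    then have "e n = e m \<longleftrightarrow> n = m"
      using kron_inj [of n N m] N m unfolding e_def by blast
    then show "coeff ([:Poly_Mapping.lookup f n:] * monom 1 (e n)) (e m) =
        (if n = m then Poly_Mapping.lookup f m else 0)"
      by simp
  qed simp
  also have "\<dots> \<noteq> 0" using m by (simp add: in_keys_iff)
  finally show ?thesis by (metis coeff_0)
qed

text \<open>Two nonempty Zariski open sets meet. One base serves both polynomials, and the product
  of the two resulting nonzero polynomials in one variable has only finitely many roots.\<close>

lemma common_nonzero:
  assumes "f \<noteq> 0" "g \<noteq> 0"
  shows "\<exists>S\<in>Sym3. evalp f S \<noteq> 0 \<and> evalp g S \<noteq> 0"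
proof -
  define E where "E = (\<lambda>(m, v). Poly_Mapping.lookup m v) ` ((Poly_Mapping.keys f \<union> Poly_Mapping.keys g) \<times> (UNIV :: coord set))"
  have "finite E" by (simp add: E_def)
  then obtain N where N: "\<forall>x\<in>E. x < N"
    using finite_nat_set_iff_bounded by auto
  let ?p = "\<lambda>v. monom 1 (kron N v) :: complex poly"
  let ?q = "psubst (\<lambda>c. [:c:]) ?p"
  have "?q f \<noteq> 0" "?q g \<noteq> 0"
    using N by (force simp: E_def intro!: psubst_kron_nonzero [OF assms(1)] psubst_kron_nonzero [OF assms(2)])+
  then have "finite {t. poly (?q f * ?q g) t = 0}"
    by (intro poly_roots_finite) simp
  then obtain t where "poly (?q f * ?q g) t \<noteq> 0"
    using ex_new_if_finite [OF infinite_UNIV_char_0] by blast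
  then have "evalp f (symm (\<lambda>v. poly (?p v) t)) \<noteq> 0" "evalp g (symm (\<lambda>v. poly (?p v) t)) \<noteq> 0"
    by (simp_all add: evalp_symm_poly)
  then show ?thesis by (intro bexI [OF conjI symm_in_Sym3])
qed

lemma evalp_eqI:
  assumes "\<And>S. S \<in> Sym3 \<Longrightarrow> evalp f S = evalp g S"
  shows "f = g"
proof (rule ccontr)
  assume "f \<noteq> g"
  then have "f - g \<noteq> 0" by simp
  from common_nonzero [OF this this] obtain S where "S \<in> Sym3" and S: "evalp (f - g) S \<noteq> 0"
    by blast
  then show False using assms [of S] by (simp add: evalp.diff)
qed

section \<open>Vanishing ideals\<close>

lemma span_singleton: "cmat.span {A} = {mscale c A | c. True}"
  by (auto simp: cmat.span_singleton)

text \<open>The vanishing ideal of a projectivization, tested on representatives. The scalar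
  \<open>c\<close> may be 0, so the constant term of \<open>f\<close> has to vanish as soon as
  \<open>X\<close> has a nonzero element.\<close>

definition cone_ideal :: "(complex^3^3) set \<Rightarrow> spoly set" where
  "cone_ideal X = {f. \<forall>A\<in>X. A \<noteq> 0 \<longrightarrow> (\<forall>c. evalp f (mscale c A) = 0)}"

lemma vanishing_ideal_projectivization: "vanishing_ideal (projectivization X) = cone_ideal X"
  by (auto simp: vanishing_ideal_def projectivization_def cone_ideal_def vanishes_at_def span_singleton)

lemma ring_ideal_cone_ideal: "ring_ideal (cone_ideal X)"
  by (auto simp: ring_ideal_def cone_ideal_def evalp.zero evalp.add evalp.mult)

section \<open>Homogeneous components and the Zariski closure\<close>

definition hcomp :: "nat \<Rightarrow> spoly \<Rightarrow> spoly" where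
  "hcomp d f = (\<Sum>m\<in>{m \<in> Poly_Mapping.keys f. mdeg m = d}. Poly_Mapping.single m (Poly_Mapping.lookup f m))"

lemma homogeneous_hcomp: "homogeneous d (hcomp d f)"
  unfolding hcomp_def by (rule homogeneous_sum) (auto simp: homogeneous_iff)

lemma monom_subst_scale: "monom_subst (\<lambda>v. c * p v) m = c ^ mdeg m * monom_subst p m"
  by (simp add: monom_subst_def power_mult_distrib prod.distrib mdeg_def power_sum)

lemma entry_mscale_fun: "entry (mscale c A) = (\<lambda>v. c * entry A v)"
  by auto

text \<open>On the line through \<open>A\<close>, the value of \<open>f\<close> at
  \<open>mscale c A\<close> is a polynomial in \<open>c\<close> whose coefficients are the values of
  the homogeneous components at \<open>A\<close>.\<close>

lemma vanishes_at_span_iff: "vanishes_at f (cmat.span {A}) \<longleftrightarrow> (\<forall>d. evalp (hcomp d f) A = 0)"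
proof -
  define q where "q = (\<Sum>m\<in>Poly_Mapping.keys f. monom (Poly_Mapping.lookup f m * monom_subst (entry A) m) (mdeg m))"
  have coeff: "coeff q d = evalp (hcomp d f) A" for d
  proof -
    have "coeff q d = (\<Sum>m\<in>Poly_Mapping.keys f. if mdeg m = d then Poly_Mapping.lookup f m * monom_subst (entry A) m else 0)"
      by (simp add: q_def coeff_sum)
    also have "\<dots> = (\<Sum>m\<in>{m \<in> Poly_Mapping.keys f. mdeg m = d}. Poly_Mapping.lookup f m * monom_subst (entry A) m)"
      by (simp add: sum.inter_filter)
    also have "\<dots> = evalp (hcomp d f) A"
      by (simp add: hcomp_def evalp_eq id_hom.psubst_sum id_hom.psubst_single)
    finally show ?thesis .
  qed
  have "evalp f (mscale c A) = poly q c" for c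
    by (simp add: q_def evalp_eq psubst_def entry_mscale_fun monom_subst_scale poly_sum poly_monom
        algebra_simps)
  then have "vanishes_at f (cmat.span {A}) \<longleftrightarrow> (\<forall>c. poly q c = 0)"
    by (auto simp: vanishes_at_def span_singleton)
  also have "\<dots> \<longleftrightarrow> q = 0"
    using poly_all_0_iff_0 by auto
  also have "\<dots> \<longleftrightarrow> (\<forall>d. coeff q d = 0)"
    by (simp add: poly_eq_iff)
  finally show ?thesis by (simp add: coeff)
qed

lemma P5_E: "P \<in> P5 \<Longrightarrow> (\<And>A. A \<in> Sym3 \<Longrightarrow> A \<noteq> 0 \<Longrightarrow> P = cmat.span {A} \<Longrightarrow> thesis) \<Longrightarrow> thesis"
  by (auto simp: P5_def projectivization_def)

lemma homogeneous_hcomp_self: "homogeneous d f \<Longrightarrow> hcomp e f = (if e = d then f else 0)"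
proof -
  assume f: "homogeneous d f"
  then have "{m \<in> Poly_Mapping.keys f. mdeg m = e} = (if e = d then Poly_Mapping.keys f else {})"
    by (auto simp: homogeneous_iff)
  then show ?thesis
    using spoly_expand [of f] by (simp add: hcomp_def)
qed

text \<open>If \<open>f\<close> vanishes on \<open>X\<close>, so do its homogeneous components;
  their common zero locus is closed and contains \<open>X\<close>, hence contains the hull. The
  ideal of the reciprocal variety can thus be computed on the inverse matrices themselves.\<close>

lemma vanishing_ideal_hull:
  assumes "X \<subseteq> P5"
  shows "vanishing_ideal (zariski_closed hull X) = vanishing_ideal X"
proof
  have "X \<subseteq> zariski_closed hull X" by (rule hull_subset)
  then show "vanishing_ideal (zariski_closed hull X) \<subseteq> vanishing_ideal X"
    by (auto simp: vanishing_ideal_def)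
  show "vanishing_ideal X \<subseteq> vanishing_ideal (zariski_closed hull X)"
  proof
    fix f assume f: "f \<in> vanishing_ideal X"
    let ?Z = "zero_locus (range (\<lambda>d. hcomp d f))"
    have *: "P \<in> ?Z \<longleftrightarrow> vanishes_at f P" if P: "P \<in> P5" for P
    proof -
      from P obtain A where A: "P = cmat.span {A}" by (rule P5_E)
      have "vanishes_at (hcomp d f) P \<longleftrightarrow> evalp (hcomp d f) A = 0" for d
        unfolding A vanishes_at_span_iff
        by (auto simp: homogeneous_hcomp_self [OF homogeneous_hcomp] evalp.zero)
      then show ?thesis
        using P by (simp add: zero_locus_def A vanishes_at_span_iff)
    qed
    have "zariski_closed ?Z"
      unfolding zariski_closed_def
      by (rule exI [of _ "range (\<lambda>d. hcomp d f)"]) (use homogeneous_hcomp in auto)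
    moreover have "X \<subseteq> ?Z"
    proof
      fix P assume "P \<in> X"
      then have "P \<in> P5" "vanishes_at f P" using f assms by (auto simp: vanishing_ideal_def)
      then show "P \<in> ?Z" using * by blast
    qed
    ultimately have "zariski_closed hull X \<subseteq> ?Z"
      by (rule hull_minimal [rotated])
    moreover have "?Z \<subseteq> P5" by (auto simp: zero_locus_def)
    ultimately have "vanishes_at f P" if "P \<in> zariski_closed hull X" for P
      using * [of P] that by blast
    then show "f \<in> vanishing_ideal (zariski_closed hull X)"
      by (simp add: vanishing_ideal_def)
  qed
qed

section \<open>Hilbert functions and degree\<close>

text \<open>The classes of \<open>u\<close> and \<open>v\<close> form a basis of the degree
  \<open>d\<close> part modulo \<open>I\<close>: adjoining \<open>u\<close> and \<open>v\<close> to
  a basis of the forms in \<open>I\<close> gives a basis of all forms.\<close>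

lemma hilbert_function_eq_2:
  assumes I: "ring_ideal I"
    and uv: "homogeneous d u" "homogeneous d v"
    and gen: "\<And>f. homogeneous d f \<Longrightarrow> \<exists>a b. f - (pscale a u + pscale b v) \<in> I"
    and indep: "\<And>a b. pscale a u + pscale b v \<in> I \<Longrightarrow> a = 0 \<and> b = 0"
  shows "hilbert_function I d = 2"
proof -
  define R where "R = {f. homogeneous d f}"
  obtain S where S: "finite S" "R \<subseteq> spoly.span S"
    unfolding R_def by (rule homogeneous_finite_span)
  have pI: "pscale a f \<in> I" if "f \<in> I" for a f
    using that by (simp add: pscale_eq ring_idealD [OF I])
  have subW: "spoly.subspace (I \<inter> R)"
    by (auto simp: spoly.subspace_def R_def ring_idealD [OF I] homogeneous_zero homogeneous_add pI homogeneous_pscale)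
  have subR: "spoly.subspace R"
    by (auto simp: spoly.subspace_def R_def homogeneous_zero homogeneous_add homogeneous_pscale)
  obtain B where B: "B \<subseteq> I \<inter> R" "spoly.independent B" "I \<inter> R \<subseteq> spoly.span B" "card B = spoly.dim (I \<inter> R)"
    by (rule spoly.basis_exists)
  have spB: "spoly.span B = I \<inter> R"
    using B subW by (intro spoly.span_subspace)
  have finB: "finite B"
    using S B by (intro spoly.independent_span_bound [OF S(1), THEN conjunct1]) auto
  have v: "v \<notin> spoly.span B"
    using indep [of 0 1] by (auto simp: spB)
  have u: "u \<notin> spoly.span (insert v B)"
  proof
    assume "u \<in> spoly.span (insert v B)"
    then obtain k where "u - pscale k v \<in> spoly.span B"
      by (auto simp: spoly.span_insert)
    then have "pscale 1 u + pscale (- k) v \<in> I"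
      by (simp add: spB)
    then show False using indep by fastforce
  qed
  have vB: "v \<notin> B" "u \<notin> insert v B"
    using u v spoly.span_base by blast+
  have ind: "spoly.independent (insert u (insert v B))"
    using B(2) u v vB by (simp add: spoly.independent_insert)
  have "spoly.span (insert u (insert v B)) = R"
  proof (rule spoly.span_subspace [OF _ _ subR])
    show "insert u (insert v B) \<subseteq> R" using B uv by (auto simp: R_def)
    show "R \<subseteq> spoly.span (insert u (insert v B))"
    proof
      fix f assume f: "f \<in> R"
      then obtain a b where ab: "f - (pscale a u + pscale b v) \<in> I"
        using gen [of f] unfolding R_def by blast
      have "pscale a u + pscale b v \<in> R"
        using uv by (simp add: R_def homogeneous_add homogeneous_pscale)
      then have "f - (pscale a u + pscale b v) \<in> spoly.span B"
        using f ab spoly.subspace_diff [OF subR] by (simp add: spB)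
      then have "(f - pscale a u) - pscale b v \<in> spoly.span B" by (simp add: algebra_simps)
      then show "f \<in> spoly.span (insert u (insert v B))"
        unfolding spoly.span_insert by blast
    qed
  qed
  then have "spoly.dim R = card (insert u (insert v B))"
    using ind by (metis spoly.dim_span_eq_card_independent)
  also have "\<dots> = card B + 2" using vB finB by simp
  finally show ?thesis
    using B(4) by (simp add: hilbert_function_def R_def)
qed

text \<open>A polynomial that takes the value \<open>k\<close> at infinitely many points is
  constant, so the Hilbert polynomial is well defined; it has degree 0 and the factorial contributes
  1.\<close>

lemma scheme_degree_eventually_const:
  assumes "\<And>d. d \<ge> d0 \<Longrightarrow> hilbert_function I d = k"
  shows "scheme_degree I = of_nat k"
proof -
  have "hilbert_polynomial I = [:of_nat k:]"
    unfolding hilbert_polynomial_def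
  proof (rule the_equality)
    show "\<exists>d0. \<forall>d\<ge>d0. poly [:of_nat k:] (of_nat d) = (of_nat (hilbert_function I d) :: rat)"
      using assms by auto
    fix q :: "rat poly"
    assume "\<exists>d0. \<forall>d\<ge>d0. poly q (of_nat d) = of_nat (hilbert_function I d)"
    then obtain d1 where d1: "\<And>d. d \<ge> d1 \<Longrightarrow> poly q (of_nat d) = of_nat (hilbert_function I d)"
      by blast
    have "of_nat ` {max d0 d1..} \<subseteq> {x. poly (q - [:of_nat k:]) x = 0}"
    proof safe
      fix d assume "max d0 d1 \<le> d"
      then have "poly q (of_nat d) = of_nat k" using assms [of d] d1 [of d] by simp
      then show "poly (q - [:of_nat k:]) (of_nat d) = 0" by simp
    qed
    moreover have "infinite (of_nat ` {max d0 d1..} :: rat set)"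
      using infinite_Ici [of "max d0 d1"]
      by (simp add: finite_image_iff inj_on_def)
    ultimately have "infinite {x. poly (q - [:of_nat k:]) x = 0}"
      using finite_subset by blast
    then have "q - [:of_nat k:] = 0"
      using poly_roots_finite by blast
    then show "q = [:of_nat k:]" by simp
  qed
  then show ?thesis by (simp add: scheme_degree_def)
qed

section \<open>Congruence\<close>

text \<open>Inverses and polar matrices transform dually to the net: when the net moves by
  \<open>act (transpose g)\<close>, they are recovered from those of the new net by
  \<open>act g\<close>.\<close>

definition act :: "complex^3^3 \<Rightarrow> complex^3^3 \<Rightarrow> complex^3^3" where
  "act g A = g ** A ** transpose g"

lemma act_act: "act g (act h A) = act (g ** h) A"
  by (simp add: act_def matrix_transpose_mul matrix_mul_assoc)

lemma act_one [simp]: "act (mat 1) A = A"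
  by (simp add: act_def transpose_mat)

lemma act_zero [simp]: "act g 0 = 0"
  by (simp add: act_def)

lemma act_Sym3: "A \<in> Sym3 \<Longrightarrow> act g A \<in> Sym3"
  by (simp add: act_def Sym3_def matrix_transpose_mul matrix_mul_assoc)

lemma act_mscale: "act g (mscale c A) = mscale c (act g A)"
  by (simp add: act_def vec_eq_iff matrix_matrix_mult_def sum_distrib_left sum_distrib_right mult_ac)

lemma act_eq_0_iff: "h ** g = mat 1 \<Longrightarrow> act g A = 0 \<longleftrightarrow> A = 0"
  by (metis act_act act_one act_zero)

text \<open>Cyclicity of the trace makes \<open>act g\<close> and \<open>act (transpose g)\<close>
  adjoint for the trace pairing.\<close>

lemma trace_act: "trace (act g A ** N) = trace (A ** act (transpose g) N)"
proof -
  have "trace (act g A ** N) = trace (g ** (A ** transpose g ** N))"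
    by (simp add: act_def matrix_mul_assoc)
  also have "\<dots> = trace ((A ** transpose g ** N) ** g)"
    by (rule trace_mul_sym)
  finally show ?thesis by (simp add: act_def matrix_mul_assoc)
qed

lemma matrix_inv_unique:
  assumes "A ** B = mat 1"
  shows "matrix_inv A = (B :: complex^3^3)"
proof -
  have BA: "B ** A = mat 1" using assms matrix_left_right_inverse by blast
  then have "A ** matrix_inv A = mat 1 \<and> matrix_inv A ** A = mat 1"
    unfolding matrix_inv_def using assms by (intro someI [of "\<lambda>B. A ** B = mat 1 \<and> B ** A = mat 1"]) simp
  then show ?thesis
    by (metis BA matrix_mul_assoc matrix_mul_lid matrix_mul_rid)
qed

lemma matrix_inv_right:
  assumes "det A \<noteq> 0"
  shows "A ** matrix_inv A = (mat 1 :: complex^3^3)"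
  using assms matrix_inv_unique unfolding invertible_det_nz [symmetric] invertible_def by metis

lemma matrix_inv_Sym3:
  assumes "A \<in> Sym3" "det A \<noteq> 0"
  shows "matrix_inv A \<in> Sym3"
proof -
  have "transpose (matrix_inv A) ** A = transpose (A ** matrix_inv A)"
    using assms(1) by (simp add: matrix_transpose_mul Sym3_def)
  also have "\<dots> = mat 1" using assms(2) by (simp add: matrix_inv_right transpose_mat)
  finally have "A ** transpose (matrix_inv A) = mat 1"
    using matrix_left_right_inverse by blast
  from matrix_inv_unique [OF this] show ?thesis by (simp add: Sym3_def)
qed

lemma det_act: "det (act g A) = det g * det A * det g"
  by (simp add: act_def det_mul)

text \<open>In the product of the two matrices the inner factor \<open>h ** g\<close> and then the
  outer factor \<open>transpose h ** transpose g\<close> cancel.\<close>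

lemma matrix_inv_act:
  assumes g: "g ** h = mat 1" and A: "det A \<noteq> 0"
  shows "matrix_inv (act (transpose h) A) = act g (matrix_inv A)"
proof (rule matrix_inv_unique)
  have hg: "h ** g = mat 1" using g matrix_left_right_inverse by blast
  have "transpose h ** transpose g = transpose (g ** h)" by (simp add: matrix_transpose_mul)
  then have t: "transpose h ** transpose g = mat 1" by (simp add: g transpose_mat)
  have "act (transpose h) A ** act g (matrix_inv A)
      = transpose h ** (A ** ((h ** g) ** matrix_inv A)) ** transpose g"
    by (simp add: act_def matrix_mul_assoc)
  also have "\<dots> = mat 1"
    by (simp add: hg matrix_inv_right [OF A] t)
  finally show "act (transpose h) A ** act g (matrix_inv A) = mat 1" .
qed

section \<open>Transport of ideals along a congruence\<close>

text \<open>Composition with the linear map \<open>act g\<close>: the coordinate \<open>w\<close> is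
  replaced by a linear form whose coefficients are the \<open>w\<close> entries of the images of the
  coordinate basis matrices.\<close>

definition pullback :: "complex^3^3 \<Rightarrow> spoly \<Rightarrow> spoly" where
  "pullback g = psubst Const
     (\<lambda>w. \<Sum>v\<in>UNIV. Const (entry (act g (symm (\<lambda>u. if u = v then 1 else 0))) w) * Var v)"

lemma entry_act:
  assumes "A \<in> Sym3"
  shows "entry (act g A) w =
    (\<Sum>v\<in>UNIV. entry (act g (symm (\<lambda>u. if u = v then 1 else 0))) w * entry A v)"
  by (cases w)
    (simp_all add: act_def matrix_matrix_mult_def transpose_def sum_3 UNIV_coord symm_def
      Sym3_nth [OF assms, of 2 1] Sym3_nth [OF assms, of 3 1] Sym3_nth [OF assms, of 3 2] algebra_simps)

lemma evalp_pullback: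
  assumes "A \<in> Sym3"
  shows "evalp (pullback g f) A = evalp f (act g A)"
proof -
  have "evalp (pullback g f) A = psubst (\<lambda>c. c) (\<lambda>w. entry (act g A) w) f"
    unfolding pullback_def evalp.psubst_hom
    by (simp add: evalp.sum evalp.mult entry_act [OF assms])
  then show ?thesis by (simp add: evalp_eq)
qed

lemma homogeneous_pullback:
  assumes "homogeneous d f"
  shows "homogeneous d (pullback g f)"
  unfolding pullback_def using assms
proof (rule homogeneous_psubst)
  show "homogeneous 1 (\<Sum>v\<in>UNIV. Const (entry (act g (symm (\<lambda>u. if u = v then 1 else 0))) w) * Var v)" for w
    using homogeneous_mult [OF homogeneous_Const homogeneous_Var] by (intro homogeneous_sum) simp
qed

text \<open>Pullback reverses composition: at \<open>A\<close> the left side is the value of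
  \<open>f\<close> at \<open>act (g ** h) A\<close>. Agreement at all symmetric matrices suffices by
  \<open>evalp_eqI\<close>.\<close>

lemma pullback_pullback:
  assumes "g ** h = mat 1"
  shows "pullback h (pullback g f) = f"
  by (rule evalp_eqI) (simp add: evalp_pullback act_Sym3 act_act assms)

lemma pullback_add: "pullback g (p + q) = pullback g p + pullback g q"
  by (simp add: pullback_def const_hom.psubst.add)

lemma pullback_diff: "pullback g (p - q) = pullback g p - pullback g q"
  by (simp add: pullback_def const_hom.psubst.diff)

lemma pullback_zero: "pullback g 0 = 0"
  by (simp add: pullback_def const_hom.psubst_zero)

lemma pullback_pscale: "pullback g (pscale c p) = pscale c (pullback g p)"
  by (simp add: pullback_def pscale_eq const_hom.psubst.mult const_hom.psubst_Const)

lemma cone_ideal_act: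
  assumes "X \<subseteq> Sym3" "h ** g = mat 1"
  shows "f \<in> cone_ideal (act g ` X) \<longleftrightarrow> pullback g f \<in> cone_ideal X"
proof -
  have "evalp f (mscale c (act g A)) = evalp (pullback g f) (mscale c A)" if "A \<in> X" for c A
    using that assms(1) by (simp add: evalp_pullback mscale_Sym3 act_mscale subset_iff)
  then show ?thesis
    by (auto simp: cone_ideal_def act_eq_0_iff [OF assms(2)])
qed

definition inverses :: "(complex^3^3) set \<Rightarrow> (complex^3^3) set" where
  "inverses L = {matrix_inv A | A. A \<in> L \<and> det A \<noteq> 0}"

lemma inverses_Sym3: "L \<subseteq> Sym3 \<Longrightarrow> inverses L \<subseteq> Sym3"
  by (auto simp: inverses_def intro: matrix_inv_Sym3)

lemma polar_net_Sym3: "polar_net L \<subseteq> Sym3"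
  by (auto simp: polar_net_def)

lemma ml_base_locus_eq:
  assumes "L \<subseteq> Sym3"
  shows "ml_base_locus L = cone_ideal (inverses L) + cone_ideal (polar_net L)"
proof -
  have "projectivization (inverses L) \<subseteq> P5"
    using inverses_Sym3 [OF assms] by (auto simp: P5_def projectivization_def)
  then show ?thesis
    by (simp add: ml_base_locus_def reciprocal_variety_def vanishing_ideal_hull
        vanishing_ideal_projectivization flip: inverses_def)
qed

lemma ring_ideal_set_plus:
  assumes I: "ring_ideal I" and J: "ring_ideal J"
  shows "ring_ideal (I + J)"
  unfolding ring_ideal_def
proof (intro conjI ballI allI)
  show "0 \<in> I + J"
    using set_plus_intro [OF ring_idealD(1) [OF I] ring_idealD(1) [OF J]] by simp
  fix x assume "x \<in> I + J"
  then obtain a b where x: "x = a + b" "a \<in> I" "b \<in> J" by (rule set_plus_elim)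
  show "r * x \<in> I + J" for r
    using x set_plus_intro [of "r * a" I "r * b" J] ring_idealD(3) [OF I] ring_idealD(3) [OF J]
    by (simp add: distrib_left)
  fix y assume "y \<in> I + J"
  then obtain c d where y: "y = c + d" "c \<in> I" "d \<in> J" by (rule set_plus_elim)
  have "(a + c) + (b + d) \<in> I + J"
    using x y by (intro set_plus_intro ring_idealD(2) [OF I] ring_idealD(2) [OF J])
  then show "x + y \<in> I + J" using x y by (simp add: algebra_simps)
qed

lemma ring_ideal_ml_base_locus: "L \<subseteq> Sym3 \<Longrightarrow> ring_ideal (ml_base_locus L)"
  by (simp add: ml_base_locus_eq ring_ideal_set_plus ring_ideal_cone_ideal)

lemma in_plus_left: "ring_ideal J \<Longrightarrow> a \<in> I \<Longrightarrow> a \<in> I + J"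
  using set_plus_intro [of a I 0 J] by (simp add: ring_idealD)

lemma in_plus_right: "ring_ideal I \<Longrightarrow> a \<in> J \<Longrightarrow> a \<in> I + J"
  using set_plus_intro [of 0 I a J] by (simp add: ring_idealD)

text \<open>The inverse of \<open>act (transpose g) A\<close> is
  \<open>act h (matrix_inv A)\<close>, and \<open>act g\<close> undoes \<open>act h\<close>.\<close>

lemma inverses_congruent:
  assumes "g ** h = mat 1"
  shows "inverses L = act g ` inverses (act (transpose g) ` L)"
proof -
  have hg: "h ** g = mat 1" using assms matrix_left_right_inverse by blast
  have dg: "det g \<noteq> 0" using arg_cong [OF assms, of det] by (auto simp: det_mul)
  have *: "act g (matrix_inv (act (transpose g) A)) = matrix_inv A" if "det A \<noteq> 0" for A
    using matrix_inv_act [OF hg that] by (simp add: act_act assms)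
  show ?thesis
    unfolding inverses_def
  proof safe
    fix A assume "A \<in> L" "det A \<noteq> 0"
    then show "matrix_inv A \<in> act g ` {matrix_inv A |A. A \<in> act (transpose g) ` L \<and> det A \<noteq> 0}"
      using * [of A] dg by (intro image_eqI [of _ _ "matrix_inv (act (transpose g) A)"]) (auto simp: det_act)
  next
    fix A assume "A \<in> L" "det (act (transpose g) A) \<noteq> 0"
    then have "det A \<noteq> 0" by (auto simp: det_act)
    with \<open>A \<in> L\<close> show "\<exists>B. act g (matrix_inv (act (transpose g) A)) = matrix_inv B \<and> B \<in> L \<and> det B \<noteq> 0"
      using * by blast
  qed
qed

lemma polar_net_congruent:
  assumes "g ** h = mat 1"
  shows "polar_net L = act g ` polar_net (act (transpose g) ` L)"
proof -
  have hg: "h ** g = mat 1" using assms matrix_left_right_inverse by blast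
  have *: "trace (act (transpose g) M ** N) = trace (M ** act g N)" for M N
    using trace_act [of "transpose g" M N] by simp
  show ?thesis
  proof safe
    fix N assume N: "N \<in> polar_net L"
    have "act g (act h N) = N" by (simp add: act_act assms)
    moreover have "act h N \<in> polar_net (act (transpose g) ` L)"
      using N by (auto simp: polar_net_def act_Sym3 * act_act assms)
    ultimately show "N \<in> act g ` polar_net (act (transpose g) ` L)" by (metis imageI)
  next
    fix N assume "N \<in> polar_net (act (transpose g) ` L)"
    then show "act g N \<in> polar_net L"
      by (auto simp: polar_net_def act_Sym3 *)
  qed
qed

text \<open>Each of the two summands of the ideal is transported separately; for the converse, a
  decomposition of \<open>pullback g f\<close> is carried back by \<open>pullback h\<close>.\<close>

lemma ml_base_locus_congruent:
  assumes L: "L \<subseteq> Sym3" and g: "g ** h = mat 1"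
  shows "f \<in> ml_base_locus L \<longleftrightarrow> pullback g f \<in> ml_base_locus (act (transpose g) ` L)"
proof -
  let ?L = "act (transpose g) ` L"
  have L': "?L \<subseteq> Sym3" using L by (auto intro: act_Sym3)
  have hg: "h ** g = mat 1" using g matrix_left_right_inverse by blast
  have 1: "f \<in> cone_ideal (inverses L) \<longleftrightarrow> pullback g f \<in> cone_ideal (inverses ?L)" for f
    unfolding inverses_congruent [OF g, of L] by (rule cone_ideal_act [OF inverses_Sym3 [OF L'] hg])
  have 2: "f \<in> cone_ideal (polar_net L) \<longleftrightarrow> pullback g f \<in> cone_ideal (polar_net ?L)" for f
    unfolding polar_net_congruent [OF g, of L] by (rule cone_ideal_act [OF polar_net_Sym3 hg])
  show ?thesis
    unfolding ml_base_locus_eq [OF L] ml_base_locus_eq [OF L']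
  proof
    assume "f \<in> cone_ideal (inverses L) + cone_ideal (polar_net L)"
    then show "pullback g f \<in> cone_ideal (inverses ?L) + cone_ideal (polar_net ?L)"
      by (rule set_plus_elim) (auto simp: pullback_add 1 2)
  next
    assume "pullback g f \<in> cone_ideal (inverses ?L) + cone_ideal (polar_net ?L)"
    then obtain a b where ab: "pullback g f = a + b" "a \<in> cone_ideal (inverses ?L)" "b \<in> cone_ideal (polar_net ?L)"
      by (rule set_plus_elim)
    have "f = pullback h a + pullback h b"
      using pullback_pullback [OF g, of f] by (simp add: ab(1) pullback_add)
    moreover have "pullback h a \<in> cone_ideal (inverses L)" "pullback h b \<in> cone_ideal (polar_net L)"
      by (simp_all add: 1 2 pullback_pullback [OF hg] ab)
    ultimately show "f \<in> cone_ideal (inverses L) + cone_ideal (polar_net L)" by auto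
  qed
qed

section \<open>The net of type F\<close>

lemma symm_nth [simp]:
  "symm x $ 1 $ 1 = x X11" "symm x $ 1 $ 2 = x X12" "symm x $ 1 $ 3 = x X13"
  "symm x $ 2 $ 1 = x X12" "symm x $ 2 $ 2 = x X22" "symm x $ 2 $ 3 = x X23"
  "symm x $ 3 $ 1 = x X13" "symm x $ 3 $ 2 = x X23" "symm x $ 3 $ 3 = x X33"
  by (simp_all add: symm_def)

text \<open>The arguments of \<open>case_coord\<close> follow the order X11, X12, X13, X22, X23,
  X33; \<open>a\<close>, \<open>b\<close>, \<open>c\<close> are the coefficients of the three
  spanning conics.\<close>

definition matF :: "complex \<Rightarrow> complex \<Rightarrow> complex \<Rightarrow> complex^3^3" where
  "matF a b c = symm (case_coord a 0 c b c 0)"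

text \<open>Up to the scalar \<open>- 1 / det\<close>, the inverse of \<open>matF a b c\<close>.\<close>

definition adjF :: "complex \<Rightarrow> complex \<Rightarrow> complex \<Rightarrow> complex^3^3" where
  "adjF a b c = symm (case_coord (c\<^sup>2) (- (c\<^sup>2)) (b * c) (c\<^sup>2) (a * c) (- (a * b)))"

lemma net_F_eq: "net_F = {matF a b c | a b c. True}"
proof
  have "cmat.subspace {matF a b c | a b c. True}"
    unfolding cmat.subspace_def
  proof (intro conjI ballI allI)
    show "0 \<in> {matF a b c | a b c. True}"
      by (auto simp: matF_def symm_def vec_eq_iff forall_3 intro!: exI [of _ 0])
    fix x assume "x \<in> {matF a b c | a b c. True}"
    then obtain a b c where x: "x = matF a b c" by auto
    have "mscale k x = matF (k * a) (k * b) (k * c)" for k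
      by (simp add: x matF_def symm_def vec_eq_iff forall_3)
    then show "mscale k x \<in> {matF a b c | a b c. True}" for k by blast
    fix y assume "y \<in> {matF a b c | a b c. True}"
    then obtain a' b' c' where y: "y = matF a' b' c'" by auto
    have "x + y = matF (a + a') (b + b') (c + c')"
      by (simp add: x y matF_def symm_def vec_eq_iff forall_3)
    then show "x + y \<in> {matF a b c | a b c. True}" by blast
  qed
  moreover have "conic_xx = matF 1 0 0" "conic_yy = matF 0 1 0" "conic_2xz_2yz = matF 0 0 1"
    by (simp_all add: matF_def symm_def conic_xx_def conic_yy_def conic_2xz_2yz_def vec_eq_iff forall_3)
  ultimately show "net_F \<subseteq> {matF a b c | a b c. True}"
    unfolding net_F_def by (intro cmat.span_minimal) auto
  have "matF a b c = mscale a conic_xx + mscale b conic_yy + mscale c conic_2xz_2yz" for a b c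
    by (simp add: matF_def symm_def conic_xx_def conic_yy_def conic_2xz_2yz_def vec_eq_iff forall_3)
  then show "{matF a b c | a b c. True} \<subseteq> net_F"
    unfolding net_F_def by (auto intro!: cmat.span_add cmat.span_scale intro: cmat.span_base)
qed

lemma net_F_Sym3: "net_F \<subseteq> Sym3"
  using is_net_net_F by (simp add: is_net_def)

lemma det_matF: "det (matF a b c) = - ((a + b) * c\<^sup>2)"
  by (simp add: det_3 matF_def symm_def power2_eq_square algebra_simps)

lemma matrix_inv_matF:
  assumes "a + b \<noteq> 0" "c \<noteq> 0"
  shows "matrix_inv (matF a b c) = mscale (1 / ((a + b) * c\<^sup>2)) (adjF a b c)"
proof (rule matrix_inv_unique)
  have "matF a b c ** adjF a b c = mscale ((a + b) * c\<^sup>2) (mat 1)"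
    by (simp add: matF_def adjF_def symm_def vec_eq_iff forall_3 matrix_matrix_mult_def sum_3 mat_def
        power2_eq_square algebra_simps)
  moreover have "A ** mscale k B = mscale k (A ** B)" for A B :: "complex^3^3" and k
    by (simp add: vec_eq_iff matrix_matrix_mult_def sum_distrib_left mult_ac)
  ultimately show "matF a b c ** mscale (1 / ((a + b) * c\<^sup>2)) (adjF a b c) = mat 1"
    using assms by simp
qed

text \<open>Invertibility means that \<open>a + b\<close> and \<open>c\<close> are nonzero. The
  inverse is then a nonzero multiple of \<open>adjF a b c\<close>, and the cone ideal does not see
  the multiple.\<close>

lemma cone_ideal_inverses_net_F:
  "f \<in> cone_ideal (inverses net_F) \<longleftrightarrow>
    (\<forall>a b c k. a + b \<noteq> 0 \<longrightarrow> c \<noteq> 0 \<longrightarrow> evalp f (mscale k (adjF a b c)) = 0)"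
proof -
  have nz: "adjF a b c \<noteq> 0" if "c \<noteq> 0" for a b c
  proof
    assume "adjF a b c = 0"
    then have "entry (adjF a b c) X11 = 0" by simp
    with that show False by (simp add: adjF_def)
  qed
  have inv: "inverses net_F = {mscale (1 / ((a + b) * c\<^sup>2)) (adjF a b c) | a b c. a + b \<noteq> 0 \<and> c \<noteq> 0}"
    (is "_ = ?R")
  proof
    show "inverses net_F \<subseteq> ?R"
    proof
      fix B assume "B \<in> inverses net_F"
      then obtain a b c where B: "B = matrix_inv (matF a b c)" and "det (matF a b c) \<noteq> 0"
        unfolding inverses_def net_F_eq by blast
      then have "a + b \<noteq> 0" "c \<noteq> 0" by (auto simp: det_matF)
      then show "B \<in> ?R"
        unfolding B by (auto simp: matrix_inv_matF)
    qed
    show "?R \<subseteq> inverses net_F"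
    proof
      fix B assume "B \<in> ?R"
      then obtain a b c where "a + b \<noteq> 0" "c \<noteq> 0"
        "B = mscale (1 / ((a + b) * c\<^sup>2)) (adjF a b c)"
        by blast
      then have "B = matrix_inv (matF a b c)" "det (matF a b c) \<noteq> 0"
        by (simp_all add: matrix_inv_matF det_matF)
      then show "B \<in> inverses net_F"
        unfolding inverses_def net_F_eq by blast
    qed
  qed
  show ?thesis
  proof
    assume f: "f \<in> cone_ideal (inverses net_F)"
    show "\<forall>a b c k. a + b \<noteq> 0 \<longrightarrow> c \<noteq> 0 \<longrightarrow> evalp f (mscale k (adjF a b c)) = 0"
    proof (intro allI impI)
      fix a b c k :: complex
      assume nz': "a + b \<noteq> 0" "c \<noteq> 0"
      let ?e = "1 / ((a + b) * c\<^sup>2)"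
      have "mscale ?e (adjF a b c) \<in> inverses net_F"
        using nz' by (auto simp: inv)
      moreover have "mscale ?e (adjF a b c) \<noteq> 0"
        using nz' nz by simp
      ultimately have "evalp f (mscale (k / ?e) (mscale ?e (adjF a b c))) = 0"
        using f unfolding cone_ideal_def by blast
      then show "evalp f (mscale k (adjF a b c)) = 0" using nz' by simp
    qed
  next
    assume "\<forall>a b c k. a + b \<noteq> 0 \<longrightarrow> c \<noteq> 0 \<longrightarrow> evalp f (mscale k (adjF a b c)) = 0"
    then show "f \<in> cone_ideal (inverses net_F)"
      by (auto simp: cone_ideal_def inv)
  qed
qed

lemma polar_net_net_F: "polar_net net_F = {symm (case_coord 0 x t 0 (- t) z) | x t z. True}"
proof -
  have tr: "trace (matF a b c ** N) = a * N $ 1 $ 1 + b * N $ 2 $ 2 + 2 * c * (N $ 1 $ 3 + N $ 2 $ 3)"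
    if "N \<in> Sym3" for a b c N
    using Sym3_nth [OF that, of 3 1] Sym3_nth [OF that, of 3 2]
    by (simp add: trace_def sum_3 matrix_matrix_mult_def matF_def symm_def algebra_simps)
  show ?thesis
  proof safe
    fix N assume N: "N \<in> polar_net net_F"
    then have "N \<in> Sym3" by (simp add: polar_net_def)
    have "trace (matF a b c ** N) = 0" for a b c
      using N by (auto simp: polar_net_def net_F_eq)
    \<comment> \<open>Pairing with the three spanning conics gives the three linear equations of the
      polar net.\<close>
    from this [of 1 0 0] this [of 0 1 0] this [of 0 0 1]
    have "N $ 1 $ 1 = 0" "N $ 2 $ 2 = 0" "N $ 2 $ 3 = - N $ 1 $ 3"
      by (simp_all add: tr \<open>N \<in> Sym3\<close> add_eq_0_iff)
    then have "N = symm (case_coord 0 (N $ 1 $ 2) (N $ 1 $ 3) 0 (- (N $ 1 $ 3)) (N $ 3 $ 3))"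
      using Sym3_nth [OF \<open>N \<in> Sym3\<close>, of 2 1] Sym3_nth [OF \<open>N \<in> Sym3\<close>, of 3 1] Sym3_nth [OF \<open>N \<in> Sym3\<close>, of 3 2]
      by (simp add: symm_def vec_eq_iff forall_3)
    then show "\<exists>x t z. N = symm (case_coord 0 x t 0 (- t) z) \<and> True" by blast
  next
    fix x t z
    show "symm (case_coord 0 x t 0 (- t) z) \<in> polar_net net_F"
      by (auto simp: polar_net_def net_F_eq tr)
  qed
qed

section \<open>The ideal of the base locus of the standard net\<close>

abbreviation ideal_F :: "spoly set" where
  "ideal_F \<equiv> ml_base_locus net_F"

lemma ring_ideal_F: "ring_ideal ideal_F"
  by (rule ring_ideal_ml_base_locus [OF net_F_Sym3])

lemma polar_in_ideal_F: "f \<in> cone_ideal (polar_net net_F) \<Longrightarrow> f \<in> ideal_F"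
  by (simp add: ml_base_locus_eq [OF net_F_Sym3] in_plus_right ring_ideal_cone_ideal)

lemma inverses_in_ideal_F: "f \<in> cone_ideal (inverses net_F) \<Longrightarrow> f \<in> ideal_F"
  by (simp add: ml_base_locus_eq [OF net_F_Sym3] in_plus_left ring_ideal_cone_ideal)

lemma generators_ideal_F:
  "Var X11 \<in> ideal_F" "Var X22 \<in> ideal_F" "Var X13 + Var X23 \<in> ideal_F"
  "Var X12 \<in> ideal_F" "Var X13 ^ 2 \<in> ideal_F"
proof -
  show 1: "Var X11 \<in> ideal_F" and 2: "Var X22 \<in> ideal_F" and 3: "Var X13 + Var X23 \<in> ideal_F"
    by (auto intro!: polar_in_ideal_F simp: cone_ideal_def polar_net_net_F evalp.add)
  have 4: "Var X11 + Var X12 \<in> ideal_F" and 5: "Var X13 * Var X23 + Var X11 * Var X33 \<in> ideal_F"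
    by (auto intro!: inverses_in_ideal_F simp: cone_ideal_inverses_net_F evalp.add evalp.mult adjF_def
        power2_eq_square algebra_simps)
  have "Var X12 = (Var X11 + Var X12) - Var X11" by simp
  then show "Var X12 \<in> ideal_F"
    by (metis 1 4 ring_ideal_F ring_idealD(6))
  \<comment> \<open>Eliminating X23 and X11 from the quadric by the linear equations leaves the
    square of X13, the source of the double structure.\<close>
  have "Var X13 ^ 2 = Var X13 * (Var X13 + Var X23) + Var X33 * Var X11
      - (Var X13 * Var X23 + Var X11 * Var X33)"
    by (simp add: power2_eq_square algebra_simps)
  also have "\<dots> \<in> ideal_F"
    by (intro ring_idealD(2,3,6) [OF ring_ideal_F] 1 3 5)
  finally show "Var X13 ^ 2 \<in> ideal_F" .
qed

text \<open>The tangent vector of the base locus at its support: modulo \<open>t\<^sup>2\<close> this curve in the polar net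
  agrees with the curve \<open>k * adjF 1 (t - 1) t\<close> in the reciprocal variety.\<close>

definition tangent_curve :: "complex \<Rightarrow> coord \<Rightarrow> complex poly" where
  "tangent_curve k = case_coord 0 0 [:0, - k:] 0 [:0, k:] [:k, - k:]"

text \<open>The summand from the polar net vanishes on the tangent curve. The summand from the
  reciprocal variety vanishes on the curve \<open>p\<close>, which agrees with the tangent curve
  modulo the square of the parameter.\<close>

lemma ideal_F_tangent:
  assumes "f \<in> ideal_F"
  shows "[:0, 0, 1:] dvd psubst (\<lambda>c. [:c:]) (tangent_curve k) f"
proof -
  from assms obtain f1 f2 where f: "f = f1 + f2"
    and f1: "f1 \<in> cone_ideal (inverses net_F)" and f2: "f2 \<in> cone_ideal (polar_net net_F)"
    unfolding ml_base_locus_eq [OF net_F_Sym3] by (rule set_plus_elim)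
  \<comment> \<open>The curve \<open>k * adjF 1 (t - 1) t\<close>: here both \<open>a + b\<close>
    and \<open>c\<close> equal \<open>t\<close>, so it comes from invertible matrices for every
    \<open>t \<noteq> 0\<close>, which gives infinitely many roots.\<close>
  define p where "p = case_coord [:0, 0, k:] [:0, 0, - k:] [:0, - k, k:] [:0, 0, k:] [:0, k:] [:k, - k:]"
  have "psubst (\<lambda>c. [:c:]) p f1 = 0"
  proof -
    have "poly (psubst (\<lambda>c. [:c:]) p f1) t = 0" if "t \<noteq> 0" for t
    proof -
      have "symm (\<lambda>v. poly (p v) t) = mscale k (adjF 1 (t - 1) t)"
        by (simp add: p_def adjF_def symm_def vec_eq_iff forall_3 power2_eq_square algebra_simps)
      then show ?thesis
        using f1 that unfolding cone_ideal_inverses_net_F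
        by (metis evalp_symm_poly add.commute diff_add_cancel)
    qed
    then have "UNIV - {0} \<subseteq> {t. poly (psubst (\<lambda>c. [:c:]) p f1) t = 0}" by auto
    moreover have "infinite (UNIV - {0 :: complex})"
      using infinite_UNIV_char_0 by (simp add: infinite_remove)
    ultimately show ?thesis
      using poly_roots_finite finite_subset by blast
  qed
  moreover have "psubst (\<lambda>c. [:c:]) (tangent_curve k) f1 - psubst (\<lambda>c. [:c:]) p f1 \<in> {q. [:0, 0, 1:] dvd q}"
  proof (rule psubst_ideal_cong)
    show "ring_ideal {q. [:0, 0, 1 :: complex:] dvd q}"
      by (auto simp: ring_ideal_def)
    have "[:0, 0, c:] = [:0, 0, 1:] * [:c:]" for c :: complex by simp
    then have "[:0, 0, 1:] dvd [:0, 0, c:]" for c :: complex by (metis dvd_triv_left)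
    then show "tangent_curve k v - p v \<in> {q. [:0, 0, 1:] dvd q}" for v
      by (cases v) (simp_all add: tangent_curve_def p_def)
  qed
  moreover have "psubst (\<lambda>c. [:c:]) (tangent_curve k) f2 = 0"
  proof -
    have "poly (psubst (\<lambda>c. [:c:]) (tangent_curve k) f2) t = 0" for t
    proof -
      let ?N = "symm (case_coord 0 0 (- t) 0 (- (- t)) (1 - t))"
      have "?N \<in> polar_net net_F" unfolding polar_net_net_F by blast
      moreover have "?N \<noteq> 0"
      proof
        assume "?N = 0"
        then have "entry ?N X23 = 0" "entry ?N X33 = 0" by simp_all
        then show False by simp
      qed
      moreover have "symm (\<lambda>v. poly (tangent_curve k v) t) = mscale k ?N"
        by (simp add: tangent_curve_def symm_def vec_eq_iff forall_3 algebra_simps)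
      ultimately show ?thesis
        using f2 by (simp add: cone_ideal_def flip: evalp_symm_poly)
    qed
    then show ?thesis using poly_all_0_iff_0 by blast
  qed
  ultimately show ?thesis by (simp add: f cpoly_hom.psubst_add)
qed

abbreviation E33 :: "complex^3^3" where
  "E33 \<equiv> symm (case_coord 0 0 0 0 0 1)"

lemma E33_nonzero: "E33 \<noteq> 0"
proof
  assume "E33 = 0"
  then have "entry E33 X33 = 0" by simp
  then show False by simp
qed

text \<open>The tangent curve passes through \<open>mscale k E33\<close> at parameter 0.\<close>

lemma ideal_F_vanishes:
  assumes "f \<in> ideal_F"
  shows "evalp f (mscale k E33) = 0"
proof -
  have "mscale k E33 = symm (\<lambda>v. poly (tangent_curve k v) 0)"
    by (simp add: tangent_curve_def symm_def vec_eq_iff forall_3)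
  moreover obtain q where "psubst (\<lambda>c. [:c:]) (tangent_curve k) f = [:0, 0, 1:] * q"
    using ideal_F_tangent [OF assms] by (rule dvdE)
  ultimately show ?thesis by (simp add: evalp_symm_poly)
qed

lemma ideal_F_zeros:
  assumes "A \<in> Sym3" "\<And>f. f \<in> ideal_F \<Longrightarrow> evalp f A = 0"
  shows "A = mscale (entry A X33) E33"
proof (rule Sym3_eqI [OF assms(1)])
  show "entry A v = entry (mscale (entry A X33) E33) v" for v
    using generators_ideal_F [THEN assms(2)]
    by (cases v) (simp_all add: evalp.add evalp.power)
qed (simp add: mscale_Sym3)

text \<open>On the tangent curve with \<open>k = 1\<close> the combination becomes
  \<open>(1 - t)^n * (a - (a + b) * t)\<close>. Divisibility by \<open>t^2\<close> forces its value
  and its derivative at 0 to vanish, that is, \<open>a = 0\<close> and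
  \<open>a + b = 0\<close>.\<close>

lemma ideal_F_independent:
  assumes "pscale a (Var X33 ^ Suc n) + pscale b (Var X13 * Var X33 ^ n) \<in> ideal_F"
  shows "a = 0 \<and> b = 0"
proof -
  let ?q = "psubst (\<lambda>c. [:c:]) (tangent_curve 1)
    (pscale a (Var X33 ^ Suc n) + pscale b (Var X13 * Var X33 ^ n))"
  have "?q = [:a:] * [:1, - 1:] ^ Suc n + [:b:] * ([:0, - 1:] * [:1, - 1:] ^ n)"
    by (simp only: pscale_eq cpoly_hom.psubst.add cpoly_hom.psubst.mult cpoly_hom.psubst.power
        cpoly_hom.psubst_Var cpoly_hom.psubst_Const tangent_curve_def coord.case)
  also have "\<dots> = [:1, - 1:] ^ n * ([:a:] * [:1, - 1:] + [:b:] * [:0, - 1:])"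
    by (simp only: power_Suc algebra_simps)
  also have "\<dots> = [:1, - 1:] ^ n * [:a, - a - b:]" by simp
  finally have "?q = [:1, - 1:] ^ n * [:a, - a - b:]" .
  moreover obtain r where r: "?q = [:0, 0, 1:] * r"
    using ideal_F_tangent [OF assms] by (rule dvdE)
  ultimately have eq: "[:1, - 1:] ^ n * [:a, - a - b:] = [:0, 0, 1:] * r" by simp
  from arg_cong [OF this, of "\<lambda>q. poly q 0"] have "a = 0"
    by simp
  moreover from arg_cong [OF eq, of "\<lambda>q. poly (pderiv q) 0"] have "a + b = 0"
    using \<open>a = 0\<close> by (simp add: pderiv_mult pderiv_pCons)
  ultimately show ?thesis by simp
qed

text \<open>Modulo the ideal, X11, X12 and X22 become 0 and X23 becomes the negative of X13. In the
  remaining monomials in X13 and X33, only exponents 0 and 1 of X13 survive.\<close>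

lemma ideal_F_generate:
  assumes f: "homogeneous (Suc n) f"
  shows "\<exists>a b. f - (pscale a (Var X33 ^ Suc n) + pscale b (Var X13 * Var X33 ^ n)) \<in> ideal_F"
proof -
  note I = ring_idealD [OF ring_ideal_F]
  let ?u = "Var X33 ^ Suc n" and ?v = "Var X13 * Var X33 ^ n"
  \<comment> \<open>A linear subspace containing the ideal; it remains to see that the reduced
    monomials of degree \<open>Suc n\<close> lie in it.\<close>
  define V where "V = {h. \<exists>a b. h - (pscale a ?u + pscale b ?v) \<in> ideal_F}"
  have V_add: "h + h' \<in> V" if hh: "h \<in> V" "h' \<in> V" for h h'
  proof -
    from hh obtain a b a' b' where "h - (pscale a ?u + pscale b ?v) \<in> ideal_F"
      "h' - (pscale a' ?u + pscale b' ?v) \<in> ideal_F"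
      unfolding V_def by blast
    from I(2) [OF this] have "h + h' - (pscale (a + a') ?u + pscale (b + b') ?v) \<in> ideal_F"
      by (simp add: spoly.scale_left_distrib algebra_simps)
    then show ?thesis unfolding V_def by blast
  qed
  have V_scale: "Const c * h \<in> V" if h: "h \<in> V" for c h
  proof -
    from h obtain a b where "h - (pscale a ?u + pscale b ?v) \<in> ideal_F"
      unfolding V_def by blast
    from I(3) [OF this, of "Const c"] have "Const c * h - (pscale (c * a) ?u + pscale (c * b) ?v) \<in> ideal_F"
      by (simp add: pscale_eq const_hom.mult algebra_simps)
    then show ?thesis unfolding V_def by blast
  qed
  have V_I: "h \<in> V" if "h \<in> ideal_F" for h
    unfolding V_def using that by (auto intro!: exI [of _ 0])
  have V_sum: "sum F S \<in> V" if "\<And>x. x \<in> S \<Longrightarrow> F x \<in> V" for F and S :: "(coord \<Rightarrow>\<^sub>0 nat) set"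
    using that by (induction S rule: infinite_finite_induct) (auto simp: V_add V_I I(1))
  have "?u - (pscale 1 ?u + pscale 0 ?v) \<in> ideal_F" "?v - (pscale 0 ?u + pscale 1 ?v) \<in> ideal_F"
    using I(1) by simp_all
  then have V_u: "?u \<in> V" and V_v: "?v \<in> V"
    unfolding V_def by blast+
  define X' where "X' = case_coord 0 0 (Var X13) 0 (- Var X13) (Var X33)"
  have "psubst Const Var f - psubst Const X' f \<in> ideal_F"
  proof (rule psubst_ideal_cong [OF ring_ideal_F])
    show "Var v - X' v \<in> ideal_F" for v
      using generators_ideal_F by (cases v) (simp_all add: X'_def I(1) add.commute)
  qed
  then have red: "f - psubst Const X' f \<in> ideal_F"
    by (simp add: psubst_Const_Var)
  have "monom_subst X' m \<in> V" if m: "mdeg m = Suc n" for m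
  proof -
    define i where "i = Poly_Mapping.lookup m X13 + Poly_Mapping.lookup m X23"
    have prod: "monom_subst X' m = X' X11 ^ Poly_Mapping.lookup m X11 * X' X12 ^ Poly_Mapping.lookup m X12 *
        X' X13 ^ Poly_Mapping.lookup m X13 * X' X22 ^ Poly_Mapping.lookup m X22 *
        X' X23 ^ Poly_Mapping.lookup m X23 * X' X33 ^ Poly_Mapping.lookup m X33"
      by (simp add: monom_subst_def UNIV_coord mult.assoc)
    show ?thesis
    proof (cases "Poly_Mapping.lookup m X11 = 0 \<and> Poly_Mapping.lookup m X12 = 0 \<and> Poly_Mapping.lookup m X22 = 0")
      case False
      then have "monom_subst X' m = 0"
        unfolding prod by (auto simp: X'_def zero_power)
      then show ?thesis by (simp add: V_I I(1))
    next
      case True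
      let ?s = "(- 1) ^ Poly_Mapping.lookup m X23 :: complex"
      have deg: "i + Poly_Mapping.lookup m X33 = Suc n"
        using m True by (simp add: mdeg_def UNIV_coord i_def)
      have "(- Var X13) ^ k = Const ((- 1) ^ k) * Var X13 ^ k" for k
        by (subst power_minus) (simp add: const_hom.power const_hom.uminus const_hom.one)
      then have mono: "monom_subst X' m = Const ?s * (Var X13 ^ i * Var X33 ^ Poly_Mapping.lookup m X33)"
        unfolding prod using True by (simp add: X'_def i_def power_add mult_ac)
      have "Var X13 ^ i * Var X33 ^ Poly_Mapping.lookup m X33 \<in> V"
      proof -
        \<comment> \<open>The exponent of X13 decides: 0 gives \<open>?u\<close>, 1 gives
          \<open>?v\<close>, and from 2 on the monomial lies in the ideal.\<close>
        consider "i = 0" | "i = 1" | j where "i = j + 2"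
        proof -
          have "i = 0 \<or> i = 1 \<or> i = (i - 2) + 2" by arith
          then show thesis using that by blast
        qed
        then show ?thesis
        proof cases
          case 1 then show ?thesis using deg V_u by simp
        next
          case 2 then show ?thesis using deg V_v by simp
        next
          case 3
          then have "Var X13 ^ i * Var X33 ^ Poly_Mapping.lookup m X33 =
              (Var X13 ^ j * Var X33 ^ Poly_Mapping.lookup m X33) * Var X13 ^ 2"
            by (simp add: power2_eq_square mult_ac)
          then show ?thesis
            by (simp only: V_I I(3) generators_ideal_F)
        qed
      qed
      then show ?thesis unfolding mono by (rule V_scale)
    qed
  qed
  then have "psubst Const X' f \<in> V"
    unfolding psubst_def using f by (intro V_sum V_scale) (simp add: homogeneous_iff)
  from V_add [OF this V_I [OF red]] show ?thesis by (simp add: V_def)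
qed

section \<open>The base locus and the ML-degree\<close>

text \<open>The matrix is the product of the third column \<open>w\<close> of \<open>g\<close> with
  its transpose, so its rows are multiples of \<open>w\<close>, and \<open>w\<close> is nonzero
  because \<open>act g\<close> is injective.\<close>

lemma rank_act_E33:
  assumes "h ** g = mat 1"
  shows "rank (act g E33) = 1"
proof -
  define w where "w = column 3 g"
  have A: "act g E33 $ i $ j = w $ i * w $ j" for i j
    by (simp add: act_def matrix_matrix_mult_def sum_3 symm_def transpose_def w_def column_def)
  have rows: "row i (act g E33) = w $ i *s w" for i
    by (simp add: row_def vec_eq_iff A)
  have "act g E33 \<noteq> 0"
    by (simp add: act_eq_0_iff [OF assms] E33_nonzero)
  then obtain i where i: "w $ i \<noteq> 0"
    by (auto simp: vec_eq_iff A)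
  have "vec.span (rows (act g E33)) = vec.span {w}"
  proof (rule vec.span_eq [THEN iffD2], intro conjI subsetI)
    show "x \<in> vec.span {w}" if "x \<in> rows (act g E33)" for x
      using that by (auto simp: rows_def rows vec.span_scale vec.span_base)
    have "(1 / w $ i) *s row i (act g E33) \<in> vec.span (rows (act g E33))"
      by (intro vec.span_scale vec.span_base) (auto simp: rows_def)
    then show "x \<in> vec.span (rows (act g E33))" if "x \<in> {w}" for x
      using that i by (simp add: rows)
  qed
  then have "rank (act g E33) = vec.dim {w}"
    unfolding row_rank_def_gen by (metis vec.dim_span)
  moreover have "w \<noteq> 0" using i by auto
  ultimately show ?thesis by simp
qed

text \<open>The support is moved from \<open>E33\<close> to \<open>act g E33\<close>, and the two
  basis forms of each degree are moved by \<open>pullback h\<close>.\<close>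

lemma double_point_F:
  assumes L: "L \<subseteq> Sym3" and gh: "g ** h = mat 1" and F: "act (transpose g) ` L = net_F"
  shows "double_point_of_rank (ml_base_locus L) 1"
proof -
  have hg: "h ** g = mat 1" using gh matrix_left_right_inverse by blast
  have I: "f \<in> ml_base_locus L \<longleftrightarrow> pullback g f \<in> ideal_F" for f
    using ml_base_locus_congruent [OF L gh] F by simp
  define A where "A = act g E33"
  have A: "A \<in> Sym3" by (simp add: A_def act_Sym3)
  have A0: "A \<noteq> 0"
    by (simp add: A_def act_eq_0_iff [OF hg] E33_nonzero)
  have "zero_locus (ml_base_locus L) = {cmat.span {A}}"
  proof
    show "zero_locus (ml_base_locus L) \<subseteq> {cmat.span {A}}"
    proof
      fix P assume P: "P \<in> zero_locus (ml_base_locus L)"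
      then have "P \<in> P5" by (simp add: zero_locus_def)
      then obtain B where B: "B \<in> Sym3" "B \<noteq> 0" "P = cmat.span {B}" by (rule P5_E)
      have "evalp f (act h B) = 0" if "f \<in> ideal_F" for f
      proof -
        have "pullback h f \<in> ml_base_locus L"
          using that by (simp add: I pullback_pullback [OF hg])
        then have "evalp (pullback h f) B = 0"
          using P by (auto simp: zero_locus_def vanishes_at_def B(3) cmat.span_base)
        then show ?thesis by (simp add: evalp_pullback B)
      qed
      then obtain k where k: "act h B = mscale k E33"
        using ideal_F_zeros act_Sym3 [OF B(1)] by blast
      have "B = act g (act h B)" by (simp add: act_act gh)
      then have BA: "B = mscale k A" by (simp add: k act_mscale A_def)
      then have "k \<noteq> 0" using B(2) by auto
      then have AB: "A = mscale (1 / k) B" by (simp add: BA)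
      have "B \<in> cmat.span {A}" "A \<in> cmat.span {B}"
        by (subst BA, simp add: cmat.span_scale cmat.span_base)
          (subst AB, simp add: cmat.span_scale cmat.span_base)
      then have "cmat.span {B} = cmat.span {A}"
        by (simp add: cmat.span_eq)
      then show "P \<in> {cmat.span {A}}" using B by simp
    qed
    have "vanishes_at f (cmat.span {A})" if "f \<in> ml_base_locus L" for f
    proof -
      have "evalp f (mscale c A) = evalp (pullback g f) (mscale c E33)" for c
        by (simp add: A_def evalp_pullback mscale_Sym3 act_mscale)
      then show ?thesis
        using that by (auto simp: vanishes_at_def span_singleton I ideal_F_vanishes)
    qed
    then show "{cmat.span {A}} \<subseteq> zero_locus (ml_base_locus L)"
      using A A0 by (auto simp: zero_locus_def P5_def projectivization_def)
  qed
  moreover have "scheme_degree (ml_base_locus L) = of_nat 2"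
  proof (rule scheme_degree_eventually_const)
    \<comment> \<open>The form divisible by X13 needs positive degree, so the constant value 2 is
      shown from degree 1 on.\<close>
    fix d :: nat assume "1 \<le> d"
    then obtain n where d: "d = Suc n" by (cases d) auto
    let ?u = "Var X33 ^ Suc n" and ?v = "Var X13 * Var X33 ^ n"
    have hom: "homogeneous (Suc n) ?u" "homogeneous (Suc n) ?v"
      using homogeneous_power [OF homogeneous_Var, of n X33] homogeneous_power [OF homogeneous_Var, of "Suc n" X33]
        homogeneous_mult [OF homogeneous_Var, of n _ X13] by simp_all
    have comb: "pullback g (pscale a (pullback h p) + pscale b (pullback h q)) = pscale a p + pscale b q" for a b p q
      by (simp add: pullback_add pullback_pscale pullback_pullback [OF hg])
    show "hilbert_function (ml_base_locus L) d = 2"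
      unfolding d
    proof (rule hilbert_function_eq_2 [OF ring_ideal_ml_base_locus [OF L]])
      show "homogeneous (Suc n) (pullback h ?u)" "homogeneous (Suc n) (pullback h ?v)"
        using hom by (simp_all only: homogeneous_pullback)
      show "\<exists>a b. f - (pscale a (pullback h ?u) + pscale b (pullback h ?v)) \<in> ml_base_locus L"
        if "homogeneous (Suc n) f" for f
        using ideal_F_generate [OF homogeneous_pullback [OF that, of g]]
        by (simp only: I pullback_diff comb)
      show "a = 0 \<and> b = 0" if "pscale a (pullback h ?u) + pscale b (pullback h ?v) \<in> ml_base_locus L" for a b
        using that unfolding I comb by (rule ideal_F_independent)
    qed
  qed
  ultimately show ?thesis
    using A A0 rank_act_E33 [OF hg] by (auto simp: double_point_of_rank_def A_def)
qed

section \<open>The ML-degree\<close>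

text \<open>Two generic conditions hold together at some \<open>S\<close>, so the generic number of
  critical points is unique.\<close>

lemma ml_degree_eqI:
  assumes "for_generic (\<lambda>S. finite (critical_points L S) \<and> card (critical_points L S) = n)"
  shows "ml_degree L = n"
  unfolding ml_degree_def
proof (rule the_equality)
  show "for_generic (\<lambda>S. finite (critical_points L S) \<and> card (critical_points L S) = n)"
    by (rule assms)
  fix k assume "for_generic (\<lambda>S. finite (critical_points L S) \<and> card (critical_points L S) = k)"
  with assms obtain f f' where "f \<noteq> 0" "f' \<noteq> 0"
    "\<And>S. S \<in> Sym3 \<Longrightarrow> evalp f S \<noteq> 0 \<Longrightarrow> card (critical_points L S) = n"
    "\<And>S. S \<in> Sym3 \<Longrightarrow> evalp f' S \<noteq> 0 \<Longrightarrow> card (critical_points L S) = k"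
    unfolding for_generic_def by blast
  then show "k = n"
    using common_nonzero [of f f'] by metis
qed

text \<open>In the coordinates of \<open>net_F\<close>, the inverse of a critical point has equal first two diagonal
  entries, and criticality in the directions \<open>x\<^sup>2\<close> and \<open>y\<^sup>2\<close> makes them the corresponding entries of
  \<open>S\<close>.\<close>

lemma ml_degree_F:
  assumes L: "L \<subseteq> Sym3" and gh: "g ** h = mat 1" and F: "act (transpose g) ` L = net_F"
  shows "ml_degree L = 0"
proof (rule ml_degree_eqI)
  have hg: "h ** g = mat 1" using gh matrix_left_right_inverse by blast
  \<comment> \<open>As a function of \<open>S\<close>, the difference of the first two diagonal
    entries of \<open>act h S\<close>, that is, of \<open>S\<close> in the coordinates of
    \<open>net_F\<close>.\<close>
  define f where "f = pullback h (Var X11 - Var X22)"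
  have "critical_points L S = {}" if S: "S \<in> Sym3" "evalp f S \<noteq> 0" for S
  proof (rule ccontr)
    assume "critical_points L S \<noteq> {}"
    then obtain M where M: "M \<in> L" "invertible M"
      and crit: "\<And>N. N \<in> L \<Longrightarrow> trace (matrix_inv M ** N) = trace (S ** N)"
      by (auto simp: critical_points_def)
    have "matrix_inv M \<in> inverses L"
      using M by (auto simp: inverses_def invertible_det_nz)
    then obtain K where K: "K \<in> inverses net_F" "matrix_inv M = act g K"
      using inverses_congruent [OF gh, of L] F by auto
    have S': "S = act g (act h S)" by (simp add: act_act gh)
    have tr: "trace (K ** N') = trace (act h S ** N')" if "N' \<in> net_F" for N'
    proof -
      from that obtain N where N: "N \<in> L" "N' = act (transpose g) N" using F by blast
      have "trace (act g K ** N) = trace (act g (act h S) ** N)"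
        using crit [OF N(1)] K(2) S' by simp
      then show ?thesis by (simp add: trace_act N(2))
    qed
    have entries: "trace (B ** matF 1 0 0) = B $ 1 $ 1" "trace (B ** matF 0 1 0) = B $ 2 $ 2" for B
      by (simp_all add: trace_def sum_3 matrix_matrix_mult_def matF_def symm_def)
    have "matF 1 0 0 \<in> net_F" "matF 0 1 0 \<in> net_F" by (auto simp: net_F_eq)
    then have "K $ 1 $ 1 = act h S $ 1 $ 1" "K $ 2 $ 2 = act h S $ 2 $ 2"
      by (metis tr entries)+
    moreover have "K $ 1 $ 1 = K $ 2 $ 2"
    proof -
      have "Var X11 - Var X22 \<in> cone_ideal (inverses net_F)"
        by (simp add: cone_ideal_inverses_net_F evalp.diff adjF_def)
      then have "evalp (Var X11 - Var X22) (mscale 1 K) = 0"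
        \<comment> \<open>The cone ideal only tests nonzero matrices; for \<open>K = 0\<close> the
          equality is trivial.\<close>
        using K(1) by (cases "K = 0") (auto simp: cone_ideal_def evalp.diff)
      then show ?thesis by (simp add: evalp.diff)
    qed
    ultimately have "evalp f S = 0"
      using S(1) by (simp add: f_def evalp_pullback evalp.diff)
    with S(2) show False by contradiction
  qed
  moreover have "f \<noteq> 0"
  proof
    assume "f = 0"
    \<comment> \<open>Pulling back along \<open>g\<close> recovers the difference of coordinates,
      which takes the value 1 at \<open>matF 1 0 0\<close>.\<close>
    then have "Var X11 - Var X22 = pullback g 0"
      using pullback_pullback [OF hg, of "Var X11 - Var X22"] by (simp add: f_def)
    then have "evalp (Var X11 - Var X22) (matF 1 0 0) = 0"
      by (simp add: pullback_zero evalp.zero)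
    then show False by (simp add: evalp.diff matF_def)
  qed
  ultimately show "for_generic (\<lambda>S. finite (critical_points L S) \<and> card (critical_points L S) = 0)"
    unfolding for_generic_def by (intro exI [of _ f]) simp
qed

theorem proposition4p9:
  fixes L :: "(complex^3^3) set"
  assumes "type_F L"
  shows "double_point_of_rank (ml_base_locus L) 1 \<and> ml_degree L = 0"
proof -
  from assms have L: "L \<subseteq> Sym3" by (simp add: type_F_def is_net_def)
  from assms obtain g where g: "invertible g" and F: "net_F = (\<lambda>M. transpose g ** M ** g) ` L"
    by (auto simp: type_F_def congruent_nets_def)
  from g obtain h where "g ** h = mat 1" by (auto simp: invertible_def)
  moreover have "act (transpose g) ` L = net_F"
    by (simp add: F act_def)
  ultimately show ?thesis
    using L double_point_F ml_degree_F by blast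
qed

end
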